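(* Let $U$ be a smooth open domain in $\mathbb R^2$ and let $f$ be a harmonic function on $U$ that extends continuously to the boundary $\partial U$. Let $T$ be a non-degenerate T-graph and let $T_n$ be $T$ rescaled by $1/n$ (so its edges are $O(1/n)$). Let $U_n=U\cap T_n$ (the vertices of $T_n$ lying in $U$) and let $\partial U_n$ denote the set of vertices of $T_n$ adjacent to $U_n$ and not in $U_n$. Let $f_n$ be the solution of the Dirichlet problem: - $f_n$ is discrete harmonic in $U_n$; - $f_n=f$ on $\partial U_n$ (where for points outside of $U$ one takes the value of $f$ at the nearest point of $\overline U$). Then the sequence $f_n$ converges pointwise to $f$ as $n\to\infty$, i.e. for every $v_\infty\in U$ and every sequence of vertices $v_n\in U_n$ with $v_n\to v_\infty$, one has $f_n(v_n)\to f(v_\infty)$.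
   Context: **Hexagonal lattice.** $\mathcal H$ is the infinite hexagonal lattice in the plane, with white vertices $w(m,n)$ and black vertices $b(m,n)$, $(m,n)\in\mathbb Z^2$. The vertex $w(m,n)$ is adjacent to $b(m,n)$ (vertical edge, $w$ directly above $b$), to $b(m,n+1)$ (NE-SW edge, $b$ to the upper right of $w$) and to $b(m-1,n+1)$ (NW-SE edge, $b$ to the upper left of $w$). $\mathcal H^*$ is the dual triangular lattice; its vertex $u(m,n)$ is the face of $\mathcal H$ immediately to the left of the vertical edge $w(m,n)b(m,n)$. Each triangular face of $\mathcal H^*$ contains exactly one vertex of $\mathcal H$ and is called white/black (and denoted by that vertex) accordingly: the white face $w(m,n)$ has vertices $u(m,n),u(m+1,n),u(m,n+1)$ and the black face $b(m,n)$ has vertices $u(m,n),u(m+1,n),u(m+1,n-1)$. **T-graph.** Let $\lambda\in\mathbb C$, $|\lambda|=1$, and let $\Delta$ be a triangle of area one with sides, as complex numbers in counterclockwise order, $a\alpha,b\beta,c\gamma$, where $a,b,c>0$ and $|\alpha|=|\beta|=|\gamma|=1$. Put $f_\Delta(w(m,n))=(\beta/\gamma)^m(\beta/\alpha)^n$, $g_\Delta(b(m,n))=\alpha(\beta/\gamma)^m(\beta/\alpha)^n$, and $K(w,b)=a,b,c$ on vertical, NE-SW, NW-SE edges respectively. There is a unique $\psi=\psi_{\lambda\Delta}$ from the vertices of $\mathcal H^*$ to $\mathbb C$ with $\psi(u(0,0))=0$ such that, when an edge $wb$ of $\mathcal H$ is crossed with the white vertex on the left, $\psi$ increases by $K(w,b)\,\mathrm{Re}(\bar\lambda\overline{f_\Delta(w)})\,\lambda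 g_\Delta(b)$. Extend $\psi$ linearly to the edges of $\mathcal H^*$; the T-graph is $T=T_{\lambda\Delta}=\psi(\mathcal H^* )\subset\mathbb C=\mathbb R^2$. Its vertices are the points $\psi(u)$, $u$ a vertex of $\mathcal H^*$. The image of a black face is a line segment, called a segment of $T$; the image of a white face is a triangle similar to $\Delta$ (possibly a point), called a face of $T$. A face is degenerate if it is a point; a segment is degenerate if it has no vertex in its interior; $T$ is non-degenerate if no face or segment is degenerate. In a non-degenerate $T$, each vertex lies in the interior of exactly one segment. **Random walk and harmonicity.** The random walk on a non-degenerate $T$ jumps from a vertex $v$ to each of the two endpoints $v^+,v^-$ of the unique segment containing $v$ in its interior, at rates $1/\|v^\pm-v\|$; $v^\pm$ are the vertices adjacent to $v$ in the sense used in the definition of $\partial U_n$. A function $h$ is discrete harmonic in a set $A$ of vertices if for every $v\in A$, $\frac{h(v^+)-h(v)}{\|v^+-v\|}+\frac{h(v^-)-h(v)}{\|v^--v\|}=0$. The same definitions are used on the rescaled graph $T_n$.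
   Formalization: The domain U is assumed bounded; otherwise "the solution" of the discrete Dirichlet problem is not unique and the claim fails (e.g. the upper half-plane with f(x,y)=y, where f_n=0 is a solution with the right boundary values). *)

theory Defs
  imports "HOL-Analysis.Analysis"
begin

section \<open>Smooth domains and harmonic functions in the plane\<close>

abbreviation dir_deriv :: "complex \<Rightarrow> (complex \<Rightarrow> real) \<Rightarrow> complex \<Rightarrow> real" where
  "dir_deriv v f \<equiv> (\<lambda>z. frechet_derivative f (at z) v)"

text \<open>Class \<open>C\<^sup>k\<close> on an open set.\<close>

primrec Ck_on :: "nat \<Rightarrow> (complex \<Rightarrow> real) \<Rightarrow> complex set \<Rightarrow> bool" where
  "Ck_on 0 f S \<longleftrightarrow> continuous_on S f"
| "Ck_on (Suc k) f S \<longleftrightarrow> f differentiable_on S \<and> (\<forall>v. Ck_on k (dir_deriv v f) S)"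

definition harmonic_on :: "(complex \<Rightarrow> real) \<Rightarrow> complex set \<Rightarrow> bool" where
  "harmonic_on f U \<longleftrightarrow> Ck_on 2 f U \<and>
     (\<forall>z\<in>U. dir_deriv 1 (dir_deriv 1 f) z + dir_deriv \<i> (dir_deriv \<i> f) z = 0)"

text \<open>A domain with \<open>C\<^sup>\<infinity>\<close> boundary, via local defining functions \<open>\<rho>\<close>.\<close>

definition smooth_domain :: "complex set \<Rightarrow> bool" where
  "smooth_domain U \<longleftrightarrow> open U \<and> connected U \<and>
     (\<forall>p\<in>frontier U. \<exists>V \<rho>. open V \<and> p \<in> V \<and> (\<forall>k. Ck_on k \<rho> V) \<and>
        (\<forall>z\<in>V. \<exists>v. dir_deriv v \<rho> z \<noteq> 0) \<and> U \<inter> V = {z \<in> V. \<rho> z < 0})"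


section \<open>The map defining a T-graph\<close>

definition unit_area_triangle ::
  "real \<Rightarrow> real \<Rightarrow> real \<Rightarrow> complex \<Rightarrow> complex \<Rightarrow> complex \<Rightarrow> bool" where
  "unit_area_triangle a b c \<alpha> \<beta> \<gamma> \<longleftrightarrow>
     0 < a \<and> 0 < b \<and> 0 < c \<and> cmod \<alpha> = 1 \<and> cmod \<beta> = 1 \<and> cmod \<gamma> = 1 \<and>
     of_real a * \<alpha> + of_real b * \<beta> + of_real c * \<gamma> = 0 \<and>
     0 < Im (cnj \<alpha> * \<beta>)  \<comment> \<open>counterclockwise\<close> \<and>
     measure lborel (convex hull {0, of_real a * \<alpha>, of_real a * \<alpha> + of_real b * \<beta>}) = 1"

definition f_Delta :: "complex \<Rightarrow> complex \<Rightarrow> complex \<Rightarrow> int \<Rightarrow> int \<Rightarrow> complex" where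
  "f_Delta \<alpha> \<beta> \<gamma> m n = (\<beta> / \<gamma>) powi m * (\<beta> / \<alpha>) powi n"

definition g_Delta :: "complex \<Rightarrow> complex \<Rightarrow> complex \<Rightarrow> int \<Rightarrow> int \<Rightarrow> complex" where
  "g_Delta \<alpha> \<beta> \<gamma> m n = \<alpha> * (\<beta> / \<gamma>) powi m * (\<beta> / \<alpha>) powi n"

text \<open>A vertex \<open>u(m,n)\<close>, \<open>w(m,n)\<close> or \<open>b(m,n)\<close> is represented by its pair of coordinates; the
  function \<open>\<psi>\<close> on the vertices of the triangular lattice is curried.

  The three neighbours \<open>b(m,n)\<close>, \<open>b(m,n+1)\<close>, \<open>b(m-1,n+1)\<close> of \<open>w(m,n)\<close> give the three sides of
  its white face, run through counterclockwise (i.e. with \<open>w(m,n)\<close> on the left):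
  \<open>u(m,n) \<rightarrow> u(m+1,n) \<rightarrow> u(m,n+1) \<rightarrow> u(m,n)\<close>.  Every edge of the
  triangular lattice is a side of exactly one white face.\<close>

definition is_psi :: "complex \<Rightarrow> real \<Rightarrow> real \<Rightarrow> real \<Rightarrow> complex \<Rightarrow> complex \<Rightarrow> complex
    \<Rightarrow> (int \<Rightarrow> int \<Rightarrow> complex) \<Rightarrow> bool" where
  "is_psi lam a b c \<alpha> \<beta> \<gamma> \<psi> \<longleftrightarrow>
     (let R = (\<lambda>m n. complex_of_real (Re (cnj lam * cnj (f_Delta \<alpha> \<beta> \<gamma> m n))));
          g = g_Delta \<alpha> \<beta> \<gamma>
      in \<psi> 0 0 = 0 \<and>
         (\<forall>m n. \<psi> (m+1) n - \<psi> m n = of_real a * R m n * (lam * g m n)) \<and>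
         (\<forall>m n. \<psi> m (n+1) - \<psi> (m+1) n = of_real b * R m n * (lam * g m (n+1))) \<and>
         (\<forall>m n. \<psi> m n - \<psi> m (n+1) = of_real c * R m n * (lam * g (m-1) (n+1))))"

definition psi :: "complex \<Rightarrow> real \<Rightarrow> real \<Rightarrow> real \<Rightarrow> complex \<Rightarrow> complex \<Rightarrow> complex
    \<Rightarrow> int \<Rightarrow> int \<Rightarrow> complex" where
  "psi lam a b c \<alpha> \<beta> \<gamma> = (THE \<psi>. is_psi lam a b c \<alpha> \<beta> \<gamma> \<psi>)"

lemma int_antidifference:
  fixes d :: "int \<Rightarrow> complex"
  shows "\<exists>h. h 0 = 0 \<and> (\<forall>k. h (k+1) - h k = d k)"
proof -
  define h where "h = (\<lambda>k. if k \<ge> 0 then sum d {0..<k} else - sum d {k..<0})"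
  have "h (k+1) - h k = d k" for k
  proof -
    consider "k \<ge> 0" | "k = -1" | "k < -1" by force
    then show ?thesis
    proof cases
      case 1
      then have "{0..<k+1} = insert k {0..<k}" by auto
      with 1 show ?thesis by (simp add: h_def)
    next
      case 2
      then have "{k..<0} = {k}" by auto
      with 2 show ?thesis by (simp add: h_def)
    next
      case 3
      then have "{k..<0} = insert k {k+1..<0}" by auto
      with 3 show ?thesis by (simp add: h_def)
    qed
  qed
  moreover have "h 0 = 0" by (simp add: h_def)
  ultimately show ?thesis by blast
qed

lemma int_fun_eqI:
  fixes f g :: "int \<Rightarrow> complex"
  assumes "\<And>k. f (k+1) - f k = g (k+1) - g k" "f 0 = g 0"
  shows "f k = g k"
proof (induction k rule: int_induct[where k=0])
  case base show ?case by (rule assms)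
next
  case (step1 i) with assms(1)[of i] show ?case by simp
next
  case (step2 i) with assms(1)[of "i-1"] show ?case by simp
qed

lemma ex1_is_psi:
  assumes "unit_area_triangle a b c \<alpha> \<beta> \<gamma>" and "cmod lam = 1"
  shows "\<exists>!\<psi>. is_psi lam a b c \<alpha> \<beta> \<gamma> \<psi>"
proof -
  have nz: "\<alpha> \<noteq> 0" "\<beta> \<noteq> 0" "\<gamma> \<noteq> 0"
    and unit: "cmod \<alpha> = 1" "cmod \<beta> = 1" "cmod \<gamma> = 1"
    and closed: "of_real a * \<alpha> + of_real b * \<beta> + of_real c * \<gamma> = 0"
    using assms(1) by (auto simp: unit_area_triangle_def)
  define f where "f = f_Delta \<alpha> \<beta> \<gamma>"
  define g where "g = g_Delta \<alpha> \<beta> \<gamma>"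
  define R where "R = (\<lambda>m n. complex_of_real (Re (cnj lam * cnj (f m n))))"
  define A where "A = (\<lambda>m n. of_real a * R m n * (lam * g m n))"
  define B where "B = (\<lambda>m n. of_real b * R m n * (lam * g m (n+1)))"
  define C where "C = (\<lambda>m n. of_real c * R m n * (lam * g (m-1) (n+1)))"
  have g1: "g m (n+1) = \<beta> / \<alpha> * g m n" for m n
    using nz by (simp add: g_def g_Delta_def power_int_add field_simps)
  have g2: "g (m-1) (n+1) = \<gamma> / \<alpha> * g m n" for m n
    using nz by (simp add: g_def g_Delta_def power_int_add power_int_diff field_simps)
  have f1: "f m n = \<beta> / \<alpha> * f m (n-1)" and f2: "f (m+1) (n-1) = \<alpha> / \<gamma> * f m n" for m n
    using nz by (simp_all add: f_def f_Delta_def power_int_add power_int_diff field_simps)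
  have white: "A m n + B m n + C m n = 0" for m n
  proof -
    have "A m n + B m n + C m n
        = R m n * lam * g m n / \<alpha> * (of_real a * \<alpha> + of_real b * \<beta> + of_real c * \<gamma>)"
      unfolding A_def B_def C_def g2 unfolding g1 using nz by (simp add: field_simps)
    with closed show ?thesis by simp
  qed
  have black: "A m n + B m (n-1) + C (m+1) (n-1) = 0" for m n
  proof -
    have cl: "of_real a / \<alpha> + of_real b / \<beta> + of_real c / \<gamma> = 0"
    proof -
      have inv: "cnj z = 1 / z" if "cmod z = 1" for z
        by (metis complex_div_cnj divide_inverse mult_1 norm_one of_real_1 one_power2 that div_by_1)
      have "cnj (of_real a * \<alpha> + of_real b * \<beta> + of_real c * \<gamma>) = 0"
        using closed by simp
      then show ?thesis using unit by (simp add: inv)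
    qed
    have cl': "of_real a + of_real b * (\<alpha> / \<beta>) + of_real c * (\<alpha> / \<gamma>) = 0"
    proof -
      have "of_real a + of_real b * (\<alpha> / \<beta>) + of_real c * (\<alpha> / \<gamma>)
          = \<alpha> * (of_real a / \<alpha> + of_real b / \<beta> + of_real c / \<gamma>)"
        using nz by (simp add: field_simps)
      with cl show ?thesis by simp
    qed
    have e1: "f m (n-1) = \<alpha> / \<beta> * f m n" using f1[of m n] nz by (simp add: field_simps)
    have "a * Re (cnj lam * cnj (f m n)) + b * Re (cnj lam * cnj (f m (n-1)))
          + c * Re (cnj lam * cnj (f (m+1) (n-1)))
        = Re (cnj (lam * f m n * (of_real a + of_real b * (\<alpha> / \<beta>) + of_real c * (\<alpha> / \<gamma>))))"
    proof -
      have "cnj (lam * f m n * (of_real a + of_real b * (\<alpha> / \<beta>) + of_real c * (\<alpha> / \<gamma>)))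
          = of_real a * (cnj lam * cnj (f m n)) + of_real b * (cnj lam * cnj (\<alpha> / \<beta> * f m n))
            + of_real c * (cnj lam * cnj (\<alpha> / \<gamma> * f m n))"
        by (simp add: algebra_simps)
      then show ?thesis unfolding e1 f2
        by (simp only: plus_complex.sel) (simp only: scaleR_conv_of_real[symmetric] scaleR_complex.sel)
    qed
    also have "\<dots> = 0" using cl' by simp
    finally have "of_real a * R m n + of_real b * R m (n-1) + of_real c * R (m+1) (n-1) = 0"
      unfolding R_def by (metis of_real_0 of_real_add of_real_mult)
    moreover have "A m n + B m (n-1) + C (m+1) (n-1)
        = (of_real a * R m n + of_real b * R m (n-1) + of_real c * R (m+1) (n-1)) * (lam * g m n)"
      by (simp add: A_def B_def C_def algebra_simps)
    ultimately show ?thesis by simp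
  qed
  have spec: "is_psi lam a b c \<alpha> \<beta> \<gamma> \<psi> \<longleftrightarrow> \<psi> 0 0 = 0 \<and> (\<forall>m n. \<psi> (m+1) n - \<psi> m n = A m n) \<and>
      (\<forall>m n. \<psi> m (n+1) - \<psi> (m+1) n = B m n) \<and> (\<forall>m n. \<psi> m n - \<psi> m (n+1) = C m n)" for \<psi>
    by (simp add: is_psi_def Let_def A_def B_def C_def R_def f_def g_def)
  obtain r where r: "r 0 = 0" "\<And>k. r (k+1) - r k = A k 0"
    using int_antidifference[of "\<lambda>k. A k 0"] by blast
  have "\<exists>h. h 0 = 0 \<and> (\<forall>k. h (k+1) - h k = - C m k)" for m
    using int_antidifference[of "\<lambda>k. - C m k"] by metis
  then obtain h where h: "\<And>m. h m 0 = 0" "\<And>m k. h m (k+1) - h m k = - C m k"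
    by metis
  define \<psi> where "\<psi> = (\<lambda>m n. r m + h m n)"
  have C: "\<psi> m n - \<psi> m (n+1) = C m n" for m n
    using h(2)[of m n] by (simp add: \<psi>_def algebra_simps)
  have A: "\<psi> (m+1) n - \<psi> m n = A m n" for m n
  proof (rule int_fun_eqI[where f = "\<lambda>n. \<psi> (m+1) n - \<psi> m n" and g = "A m"])
    show "\<psi> (m+1) 0 - \<psi> m 0 = A m 0" using r(2)[of m] by (simp add: \<psi>_def h(1))
    fix k
    have "C m k - C (m+1) k = A m (k+1) - A m k"
      using white[of m k] black[of m "k+1"] by (simp add: algebra_simps) (metis add.left_commute add_left_cancel add.commute)
    then show "\<psi> (m+1) (k+1) - \<psi> m (k+1) - (\<psi> (m+1) k - \<psi> m k) = A m (k+1) - A m k"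
      using C[of m k] C[of "m+1" k] by (simp add: algebra_simps)
  qed
  have B: "\<psi> m (n+1) - \<psi> (m+1) n = B m n" for m n
  proof -
    have "B m n = - A m n - C m n"
      using white[of m n] by (metis add.commute add_diff_cancel_right' add_uminus_conv_diff diff_0)
    then show ?thesis by (simp flip: A C)
  qed
  show ?thesis
  proof (rule ex1I[of _ \<psi>])
    show "is_psi lam a b c \<alpha> \<beta> \<gamma> \<psi>"
      unfolding spec using A B C by (simp add: \<psi>_def r(1) h(1))
  next
    fix \<phi> assume "is_psi lam a b c \<alpha> \<beta> \<gamma> \<phi>"
    then have \<phi>: "\<phi> 0 0 = 0" "\<And>m n. \<phi> (m+1) n - \<phi> m n = A m n" "\<And>m n. \<phi> m n - \<phi> m (n+1) = C m n"
      unfolding spec by auto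
    have row: "\<phi> m 0 = \<psi> m 0" for m
      by (rule int_fun_eqI) (simp_all add: \<phi> A, simp add: \<psi>_def r h)
    have "\<phi> m n = \<psi> m n" for m n
    proof (rule int_fun_eqI[where f = "\<phi> m"])
      fix k show "\<phi> m (k+1) - \<phi> m k = \<psi> m (k+1) - \<psi> m k"
        using \<phi>(3)[of m k] C[of m k] by (metis minus_diff_eq)
    qed (rule row)
    then show "\<phi> = \<psi>" by blast
  qed
qed


section \<open>T-graphs and discrete harmonic functions\<close>

text \<open>The notions below are stated for an arbitrary map \<open>\<phi>\<close> on the vertices of the triangular
  lattice, to be used for \<open>\<psi>\<close> and for its rescalings.  The linear extension of \<open>\<phi>\<close>
  maps the boundary of a face onto the edges joining the three image points; for a black face
  these points are collinear in the case of \<open>\<psi>\<close>, and their convex hull is a (possibly degenerate)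
  segment.\<close>

definition vertices :: "(int \<Rightarrow> int \<Rightarrow> complex) \<Rightarrow> complex set" where
  "vertices \<phi> = {\<phi> m n | m n. True}"

definition white_face :: "(int \<Rightarrow> int \<Rightarrow> complex) \<Rightarrow> int \<Rightarrow> int \<Rightarrow> complex set" where
  "white_face \<phi> m n = convex hull {\<phi> m n, \<phi> (m+1) n, \<phi> m (n+1)}"

definition black_face :: "(int \<Rightarrow> int \<Rightarrow> complex) \<Rightarrow> int \<Rightarrow> int \<Rightarrow> complex set" where
  "black_face \<phi> m n = convex hull {\<phi> m n, \<phi> (m+1) n, \<phi> (m+1) (n-1)}"

definition faces :: "(int \<Rightarrow> int \<Rightarrow> complex) \<Rightarrow> complex set set" where
  "faces \<phi> = {white_face \<phi> m n | m n. True}"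

definition segments :: "(int \<Rightarrow> int \<Rightarrow> complex) \<Rightarrow> complex set set" where
  "segments \<phi> = {black_face \<phi> m n | m n. True}"

definition nondegenerate :: "(int \<Rightarrow> int \<Rightarrow> complex) \<Rightarrow> bool" where
  "nondegenerate \<phi> \<longleftrightarrow>
     (\<forall>F\<in>faces \<phi>. \<nexists>p. F = {p}) \<and>
     (\<forall>S\<in>segments \<phi>. \<exists>p q. S = closed_segment p q \<and> open_segment p q \<inter> vertices \<phi> \<noteq> {})"

text \<open>\<open>p\<close> and \<open>q\<close> are the endpoints (in either order) of a segment containing \<open>v\<close> in its
  interior.  In a non-degenerate T-graph every vertex lies in the interior of exactly one
  segment, so \<open>{p, q}\<close> is then determined by \<open>v\<close>.\<close>

definition splits :: "(int \<Rightarrow> int \<Rightarrow> complex) \<Rightarrow> complex \<Rightarrow> complex \<Rightarrow> complex \<Rightarrow> bool" where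
  "splits \<phi> v p q \<longleftrightarrow> closed_segment p q \<in> segments \<phi> \<and> v \<in> open_segment p q"

definition discrete_harmonic ::
  "(int \<Rightarrow> int \<Rightarrow> complex) \<Rightarrow> (complex \<Rightarrow> real) \<Rightarrow> complex set \<Rightarrow> bool" where
  "discrete_harmonic \<phi> h A \<longleftrightarrow>
     (\<forall>v\<in>A. \<forall>p q. splits \<phi> v p q \<longrightarrow> (h p - h v) / norm (p - v) + (h q - h v) / norm (q - v) = 0)"

definition inner_vertices :: "(int \<Rightarrow> int \<Rightarrow> complex) \<Rightarrow> complex set \<Rightarrow> complex set" where
  "inner_vertices \<phi> U = U \<inter> vertices \<phi>"

definition boundary_vertices :: "(int \<Rightarrow> int \<Rightarrow> complex) \<Rightarrow> complex set \<Rightarrow> complex set" where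
  "boundary_vertices \<phi> U =
     {p \<in> vertices \<phi>. \<exists>v\<in>inner_vertices \<phi> U. \<exists>q. splits \<phi> v p q} - inner_vertices \<phi> U"

text \<open>Where several points of the closure of \<open>U\<close> are nearest to a boundary vertex,
  \<^const>\<open>closest_point\<close> selects one of them.  For the rescaled T-graphs, the boundary vertices
  are at distance \<open>O(1/n)\<close> from a smooth bounded \<open>U\<close>, so for large \<open>n\<close> the nearest point is unique.\<close>

definition dirichlet_solution ::
  "(int \<Rightarrow> int \<Rightarrow> complex) \<Rightarrow> complex set \<Rightarrow> (complex \<Rightarrow> real) \<Rightarrow> (complex \<Rightarrow> real) \<Rightarrow> bool" where
  "dirichlet_solution \<phi> U f h \<longleftrightarrow>
     discrete_harmonic \<phi> h (inner_vertices \<phi> U) \<and>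
     (\<forall>v\<in>boundary_vertices \<phi> U. h v = f (closest_point (closure U) v))"

definition rescaled :: "nat \<Rightarrow> (int \<Rightarrow> int \<Rightarrow> complex) \<Rightarrow> int \<Rightarrow> int \<Rightarrow> complex" where
  "rescaled n \<phi> = (\<lambda>i j. \<phi> i j / of_nat n)"

end

theory Submission
  imports Defs
begin

text \<open>
  Because \<open>f_Delta\<close> is multiplicative, \<open>\<psi>\<close> is the sum of a linear map \<open>L\<close> and a bounded
  exponential \<open>\<kappa> (E - 1)\<close>.  A function on the vertices is discrete harmonic as soon as it is affine
  on every black face, and there is such a function at bounded distance from \<open>\<psi>\<^sup>2\<close>: take slope
  \<open>L\<close> on each black face (a discrete \<open>\<integral> \<psi> d\<psi>\<close>) and correct it by real-linear functions of \<open>\<psi>\<close>.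
  Hence, after rescaling by \<open>1/n\<close>, every harmonic polynomial of degree at most two is discrete
  harmonic up to \<open>O(1/n\<^sup>2)\<close>, and this replaces the central limit theorem for the random walk.

  Comparing a discrete harmonic function with a strictly superharmonic function \<open>W\<close> on a small ball of
  fixed radius around a maximum of the difference, with \<open>W\<close> replaced by its second-order expansion,
  gives a comparison principle.  It is applied first with barriers from exterior balls, then with
  \<open>f + \<epsilon> (R\<^sup>2 - \<bar>z\<bar>\<^sup>2)\<close>, and to \<open>-f\<close> for the lower bound.
\<close>

section \<open>Functions affine on black faces\<close>

text \<open>A step of the walk moves along one segment, so its covariance has rank one, and the
  discrete Laplacian of a smooth harmonic function is in general of the same order as that of |z|^2.
  Isotropy appears only after averaging over many faces, and the corrector encodes this averaging
  exactly. Its boundedness is decisive: after rescaling, the error is O(1/n^2) uniformly on a ball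
  whose radius does not depend on n, while a strictly superharmonic function loses a fixed amount
  across that ball. One complex corrector, for z^2, covers all trace-free Hessians, since these are
  the forms Re (A h^2). For |z|^2 only the sign of the discrete Laplacian is used, as no uniform
  lower bound on the jumps is provided. Near the boundary f is merely continuous and boundary
  vertices may lie outside U, so no expansion of f is at hand there. The barriers give a bound in a
  boundary layer, which then serves as boundary data for the comparison inside.\<close>

text \<open>The points \<open>\<psi>\<close> of the black face \<open>b(m,n)\<close> lie on a line and differ by the real multiples
  \<open>a R(m,n)\<close>, \<open>b R(m,n-1)\<close>, \<open>c R(m+1,n-1)\<close> of its direction; \<open>\<sigma>\<close> is the slope of \<open>h\<close>
  along that line.\<close>

definition affine_on_black ::
  "real \<Rightarrow> real \<Rightarrow> real \<Rightarrow> (int \<Rightarrow> int \<Rightarrow> real) \<Rightarrow> (int \<Rightarrow> int \<Rightarrow> complex) \<Rightarrow> bool" where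
  "affine_on_black a b c R h \<longleftrightarrow> (\<forall>m n. \<exists>\<sigma>.
     h (m+1) n - h m n = of_real (a * R m n) * \<sigma> \<and>
     h m n - h (m+1) (n-1) = of_real (b * R m (n-1)) * \<sigma> \<and>
     h (m+1) (n-1) - h (m+1) n = of_real (c * R (m+1) (n-1)) * \<sigma>)"

lemma affine_on_black_add:
  assumes "affine_on_black a b c R h" "affine_on_black a b c R k"
  shows "affine_on_black a b c R (\<lambda>m n. h m n + k m n)"
  unfolding affine_on_black_def
proof (intro allI)
  fix m n
  obtain s t where
    "h (m+1) n - h m n = of_real (a * R m n) * s"
    "h m n - h (m+1) (n-1) = of_real (b * R m (n-1)) * s"
    "h (m+1) (n-1) - h (m+1) n = of_real (c * R (m+1) (n-1)) * s"
    "k (m+1) n - k m n = of_real (a * R m n) * t"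
    "k m n - k (m+1) (n-1) = of_real (b * R m (n-1)) * t"
    "k (m+1) (n-1) - k (m+1) n = of_real (c * R (m+1) (n-1)) * t"
    using assms unfolding affine_on_black_def by meson
  then show "\<exists>\<sigma>. h (m+1) n + k (m+1) n - (h m n + k m n) = of_real (a * R m n) * \<sigma> \<and>
     h m n + k m n - (h (m+1) (n-1) + k (m+1) (n-1)) = of_real (b * R m (n-1)) * \<sigma> \<and>
     h (m+1) (n-1) + k (m+1) (n-1) - (h (m+1) n + k (m+1) n) = of_real (c * R (m+1) (n-1)) * \<sigma>"
    by (intro exI[of _ "s + t"]) (simp only: ring_distribs, simp add: add_diff_add)
qed

lemma affine_on_black_cmult:
  assumes "affine_on_black a b c R h"
  shows "affine_on_black a b c R (\<lambda>m n. k * h m n)"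
  unfolding affine_on_black_def
proof (intro allI)
  fix m n
  obtain s where
    "h (m+1) n - h m n = of_real (a * R m n) * s"
    "h m n - h (m+1) (n-1) = of_real (b * R m (n-1)) * s"
    "h (m+1) (n-1) - h (m+1) n = of_real (c * R (m+1) (n-1)) * s"
    using assms unfolding affine_on_black_def by meson
  then show "\<exists>\<sigma>. k * h (m+1) n - k * h m n = of_real (a * R m n) * \<sigma> \<and>
     k * h m n - k * h (m+1) (n-1) = of_real (b * R m (n-1)) * \<sigma> \<and>
     k * h (m+1) (n-1) - k * h (m+1) n = of_real (c * R (m+1) (n-1)) * \<sigma>"
    by (intro exI[of _ "k * s"]) (simp flip: right_diff_distrib)
qed

lemma affine_on_black_cnj:
  assumes "affine_on_black a b c R h"
  shows "affine_on_black a b c R (\<lambda>m n. cnj (h m n))"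
  unfolding affine_on_black_def
proof (intro allI)
  fix m n
  obtain s where
    "h (m+1) n - h m n = of_real (a * R m n) * s"
    "h m n - h (m+1) (n-1) = of_real (b * R m (n-1)) * s"
    "h (m+1) (n-1) - h (m+1) n = of_real (c * R (m+1) (n-1)) * s"
    using assms unfolding affine_on_black_def by meson
  then show "\<exists>\<sigma>. cnj (h (m+1) n) - cnj (h m n) = of_real (a * R m n) * \<sigma> \<and>
     cnj (h m n) - cnj (h (m+1) (n-1)) = of_real (b * R m (n-1)) * \<sigma> \<and>
     cnj (h (m+1) (n-1)) - cnj (h (m+1) n) = of_real (c * R (m+1) (n-1)) * \<sigma>"
    by (intro exI[of _ "cnj s"]) (simp flip: complex_cnj_diff)
qed

text \<open>Each vertex belongs to three white faces and of the three signs of \<open>R\<close> there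
  two agree; the black face between these two white faces is the one whose segment
  contains the vertex in its interior.\<close>

lemma black_middle:
  assumes pos: "0 < a" "0 < b" "0 < c" and nz: "\<And>m n. R m n \<noteq> 0"
  shows "\<exists>i j k l m' n' t. 0 < t \<and> t < 1 \<and>
     {(m, n), (i, j), (k, l)} = {(m', n'), (m'+1, n'), (m'+1, n'-1)} \<and>
     (\<forall>h. affine_on_black a b c R h \<longrightarrow>
        h m n = of_real (1 - t) * h i j + of_real t * h k l)"
proof -
  \<comment> \<open>The weight r / (r + s) depends only on the coefficients and not on the slope
    \<sigma>, so one t serves all functions that are affine on black faces.\<close>
  have weights: "\<exists>t. 0 < t \<and> t < 1 \<and> (\<forall>(x::complex) y z \<sigma>. y - x = of_real r * \<sigma> \<longrightarrow>
      x - z = of_real s * \<sigma> \<longrightarrow> x = of_real (1 - t) * y + of_real t * z)" if "0 < r * s" for r s :: real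
  proof (intro exI[of _ "r / (r + s)"] conjI allI impI)
    have rs: "(0 < r \<and> 0 < s) \<or> (r < 0 \<and> s < 0)" using that by (auto simp: zero_less_mult_iff)
    then show "0 < r / (r + s)" "r / (r + s) < 1" by (auto simp: field_simps zero_less_divide_iff)
    fix x y z \<sigma> :: complex
    assume "y - x = of_real r * \<sigma>" "x - z = of_real s * \<sigma>"
    then have y: "y = x + of_real r * \<sigma>" and z: "z = x - of_real s * \<sigma>" by (simp_all add: algebra_simps)
    define \<theta> where "\<theta> = r / (r + s)"
    have "\<theta> * (r + s) = r" using rs by (auto simp: \<theta>_def)
    then have "(1 - \<theta>) * r - \<theta> * s = 0" by (simp add: algebra_simps)
    moreover have "of_real (1 - \<theta>) * y + of_real \<theta> * z = x + of_real ((1 - \<theta>) * r - \<theta> * s) * \<sigma>"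
      unfolding y z by (simp add: algebra_simps)
    ultimately show "x = of_real (1 - r / (r + s)) * y + of_real (r / (r + s)) * z"
      by (simp add: \<theta>_def)
  qed
  have "R m n * R m (n-1) > 0 \<or> R m n * R (m-1) n > 0 \<or> R (m-1) n * R m (n-1) > 0"
    using nz[of m n] nz[of m "n-1"] nz[of "m-1" n] by (auto simp: zero_less_mult_iff neq_iff)
  then consider "(a * R m n) * (b * R m (n-1)) > 0" | "(b * R (m-1) n) * (c * R m n) > 0"
    | "(c * R m (n-1)) * (a * R (m-1) n) > 0"
    using pos by (auto simp: zero_less_mult_iff mult_less_0_iff)
  then show ?thesis
  proof cases
    case 1
    from weights[OF this] obtain t where t: "0 < t" "t < 1"
      "\<And>(x::complex) y z \<sigma>. y - x = of_real (a * R m n) * \<sigma> \<Longrightarrow>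
      x - z = of_real (b * R m (n-1)) * \<sigma> \<Longrightarrow> x = of_real (1 - t) * y + of_real t * z" by blast
    have "\<forall>h. affine_on_black a b c R h \<longrightarrow>
        h m n = of_real (1 - t) * h (m+1) n + of_real t * h (m+1) (n-1)"
      unfolding affine_on_black_def using t(3) by meson
    moreover have "{(m, n), (m+1, n), (m+1, n-1)} = {(m, n), (m+1, n), (m+1, n-1)}"
      by (simp add: insert_commute)
    ultimately show ?thesis using t(1,2)
      by - (rule exI[of _ "m+1"], rule exI[of _ n], rule exI[of _ "m+1"], rule exI[of _ "n-1"],
          rule exI[of _ m], rule exI[of _ n], rule exI[of _ t], blast)
  next
    case 2
    from weights[OF this] obtain t where t: "0 < t" "t < 1"
      "\<And>(x::complex) y z \<sigma>. y - x = of_real (b * R (m-1) n) * \<sigma> \<Longrightarrow>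
      x - z = of_real (c * R m n) * \<sigma> \<Longrightarrow> x = of_real (1 - t) * y + of_real t * z" by blast
    have "h m n = of_real (1 - t) * h (m-1) (n+1) + of_real t * h m (n+1)"
      if "affine_on_black a b c R h" for h
    proof -
      have "\<exists>\<sigma>. h (m-1) (n+1) - h (m-1+1) (n+1-1) = of_real (b * R (m-1) (n+1-1)) * \<sigma> \<and>
        h (m-1+1) (n+1-1) - h (m-1+1) (n+1) = of_real (c * R (m-1+1) (n+1-1)) * \<sigma>"
        using that unfolding affine_on_black_def by meson
      then show ?thesis using t(3) by auto
    qed
    moreover have "{(m, n), (m-1, n+1), (m, n+1)} = {(m-1, n+1), (m-1+1, n+1), (m-1+1, n+1-1)}"
      by (simp add: insert_commute)
    ultimately show ?thesis using t(1,2)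
      by - (rule exI[of _ "m-1"], rule exI[of _ "n+1"], rule exI[of _ m], rule exI[of _ "n+1"],
          rule exI[of _ "m-1"], rule exI[of _ "n+1"], rule exI[of _ t], blast)
  next
    case 3
    from weights[OF this] obtain t where t: "0 < t" "t < 1"
      "\<And>(x::complex) y z \<sigma>. y - x = of_real (c * R m (n-1)) * \<sigma> \<Longrightarrow>
      x - z = of_real (a * R (m-1) n) * \<sigma> \<Longrightarrow> x = of_real (1 - t) * y + of_real t * z" by blast
    have "h m n = of_real (1 - t) * h m (n-1) + of_real t * h (m-1) n"
      if "affine_on_black a b c R h" for h
    proof -
      have "\<exists>\<sigma>. h (m-1+1) (n-1) - h (m-1+1) n = of_real (c * R (m-1+1) (n-1)) * \<sigma> \<and>
        h (m-1+1) n - h (m-1) n = of_real (a * R (m-1) n) * \<sigma>"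
        using that unfolding affine_on_black_def by meson
      then show ?thesis using t(3) by auto
    qed
    moreover have "{(m, n), (m, n-1), (m-1, n)} = {(m-1, n), (m-1+1, n), (m-1+1, n-1)}"
      by (simp add: insert_commute)
    ultimately show ?thesis using t(1,2)
      by - (rule exI[of _ m], rule exI[of _ "n-1"], rule exI[of _ "m-1"], rule exI[of _ n],
          rule exI[of _ "m-1"], rule exI[of _ n], rule exI[of _ t], blast)
  qed
qed

lemma convex_hull_three_collinear:
  fixes u p q :: "'a::real_vector"
  assumes "u \<in> closed_segment p q"
  shows "convex hull {u, p, q} = closed_segment p q"
  using hull_redundant[of u convex "{p, q}"] assms by (simp add: segment_convex_hull)

section \<open>Comparison on graphs with a quadratic corrector\<close>

text \<open>The neighbours of \<open>u\<close> are \<open>P u\<close> and \<open>Q u\<close>; the jump rates \<open>1 / \<bar>Z (P u) - Z u\<bar>\<close> and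
  \<open>1 / \<bar>Z (Q u) - Z u\<bar>\<close> are proportional to \<open>1 - t u\<close> and \<open>t u\<close>.  Vertices are abstract indices
  rather than points of the plane, so that no injectivity of \<open>Z\<close> is needed.\<close>

locale balanced_graph =
  fixes Z G :: "'v \<Rightarrow> complex" and P Q :: "'v \<Rightarrow> 'v" and t :: "'v \<Rightarrow> real" and C D :: real
  assumes t: "0 < t u" "t u < 1"
    and Z: "Z u = of_real (1 - t u) * Z (P u) + of_real (t u) * Z (Q u)"
    and G: "G u = of_real (1 - t u) * G (P u) + of_real (t u) * G (Q u)"
    and PQ: "Z (P u) \<noteq> Z (Q u)"
    and corrector: "cmod (G u - (Z u)\<^sup>2) \<le> C"
    and step: "cmod (Z (P u) - Z u) \<le> D" "cmod (Z (Q u) - Z u) \<le> D"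
    and locally_finite: "finite {u. cmod (Z u) \<le> r}"
begin

definition harmonic_at :: "('v \<Rightarrow> real) \<Rightarrow> 'v \<Rightarrow> bool" where
  "harmonic_at h u \<longleftrightarrow> h u = (1 - t u) * h (P u) + t u * h (Q u)"

lemma harmonic_at_Re_Z: "harmonic_at (\<lambda>u. Re (B * Z u)) u"
proof -
  have "B * Z u = of_real (1 - t u) * (B * Z (P u)) + of_real (t u) * (B * Z (Q u))"
    by (subst Z) (simp add: algebra_simps)
  then show ?thesis unfolding harmonic_at_def by simp
qed

lemma harmonic_at_Re_G: "harmonic_at (\<lambda>u. Re (B * G u)) u"
proof -
  have "B * G u = of_real (1 - t u) * (B * G (P u)) + of_real (t u) * (B * G (Q u))"
    by (subst G) (simp add: algebra_simps)
  then show ?thesis unfolding harmonic_at_def by simp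
qed

lemma harmonic_at_diff: "harmonic_at h u \<Longrightarrow> harmonic_at k u \<Longrightarrow> harmonic_at (\<lambda>u. h u - k u) u"
  unfolding harmonic_at_def by (simp add: algebra_simps)

lemma harmonic_at_add: "harmonic_at h u \<Longrightarrow> harmonic_at k u \<Longrightarrow> harmonic_at (\<lambda>u. h u + k u) u"
  unfolding harmonic_at_def by (simp add: algebra_simps)

lemma harmonic_at_const: "harmonic_at (\<lambda>u. k) u"
  unfolding harmonic_at_def by (simp add: algebra_simps)

text \<open>The gap is the variance t (1 - t) |p - q|^2 of the two-point distribution with weights 1
  - t and t. It may be arbitrarily small in this setting, so only strictness is claimed.\<close>

lemma square_strictly_subharmonic:
  fixes N :: real
  assumes "N > 0"
  shows "(cmod (Z u / N - v))\<^sup>2 <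
     (1 - t u) * (cmod (Z (P u) / N - v))\<^sup>2 + t u * (cmod (Z (Q u) / N - v))\<^sup>2"
proof -
  define p where "p = Z (P u) / N - v"
  define q where "q = Z (Q u) / N - v"
  have u: "Z u / N - v = of_real (1 - t u) * p + of_real (t u) * q"
    by (subst Z) (use assms in \<open>simp add: p_def q_def field_simps\<close>)
  have "p \<noteq> q" using PQ[of u] assms by (simp add: p_def q_def)
  then have "0 < t u * (1 - t u) * (cmod (p - q))\<^sup>2"
    using t[of u] by simp
  also have "\<dots> = (1 - t u) * (cmod p)\<^sup>2 + t u * (cmod q)\<^sup>2
      - (cmod (of_real (1 - t u) * p + of_real (t u) * q))\<^sup>2"
    by (simp add: cmod_power2) (simp add: power2_eq_square algebra_simps)
  finally show ?thesis unfolding u p_def q_def by simp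
qed

text \<open>The added square makes the sum strictly subharmonic on S, so at a maximum point over S
  some neighbour has a larger value and must lie outside S. The square stays in the conclusion
  because \<epsilon> will be a fixed constant, not a vanishing perturbation.\<close>

lemma maximum_principle:
  fixes h :: "'v \<Rightarrow> real" and N \<epsilon> :: real
  assumes "finite S" "u \<in> S" "\<And>x. x \<in> S \<Longrightarrow> harmonic_at h x" "N > 0" "\<epsilon> > 0"
  shows "\<exists>x\<in>S. \<exists>y\<in>{P x, Q x}. y \<notin> S \<and>
     h u + \<epsilon> * (cmod (Z u / N - v))\<^sup>2 \<le> h y + \<epsilon> * (cmod (Z y / N - v))\<^sup>2"
proof -
  define k where "k = (\<lambda>x. h x + \<epsilon> * (cmod (Z x / N - v))\<^sup>2)"
  obtain x where x: "x \<in> S" "\<And>y. y \<in> S \<Longrightarrow> k y \<le> k x"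
    using obtains_MAX[OF assms(1), of k] assms(2) by (metis empty_iff Max_ge assms(1) finite_imageI imageI)
  have "\<epsilon> * (cmod (Z x / N - v))\<^sup>2 < \<epsilon> *
     ((1 - t x) * (cmod (Z (P x) / N - v))\<^sup>2 + t x * (cmod (Z (Q x) / N - v))\<^sup>2)"
    using square_strictly_subharmonic[OF \<open>N > 0\<close>] \<open>\<epsilon> > 0\<close> by simp
  then have lt: "k x < (1 - t x) * k (P x) + t x * k (Q x)"
    using assms(3)[OF x(1)] unfolding k_def harmonic_at_def by (simp add: algebra_simps)
  have "\<exists>y\<in>{P x, Q x}. k x < k y"
  proof (rule ccontr)
    assume "\<not> ?thesis"
    then have le: "k (P x) \<le> k x" "k (Q x) \<le> k x" by auto
    have "(1 - t x) * k (P x) + t x * k (Q x) \<le> (1 - t x) * k x + t x * k x"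
      using le t[of x] by (intro add_mono mult_left_mono) auto
    then show False using lt by (simp add: algebra_simps)
  qed
  then obtain y where y: "y \<in> {P x, Q x}" "k x < k y" by blast
  moreover have "y \<notin> S" using x(2)[of y] y(2) by auto
  moreover have "k u \<le> k y" using x(2)[OF assms(2)] y(2) by simp
  ultimately show ?thesis using x(1) unfolding k_def by blast
qed

text \<open>\<open>Re (B \<zeta> + A \<zeta>\<^sup>2)\<close> at \<open>\<zeta> = Z x / N - v\<close>, with \<open>(Z x)\<^sup>2\<close> replaced by \<open>G x\<close>.\<close>

definition corrected :: "real \<Rightarrow> complex \<Rightarrow> complex \<Rightarrow> complex \<Rightarrow> 'v \<Rightarrow> real" where
  "corrected N v A B x = Re (B * (Z x / N - v)) + Re (A * (G x / N\<^sup>2 - 2 * v * (Z x / N) + v\<^sup>2))"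

lemma corrected_harmonic: "harmonic_at (corrected N v A B) x"
proof -
  have eq: "corrected N v A B = (\<lambda>x. Re ((B / N - 2 * A * v / N) * Z x) + Re ((A / N\<^sup>2) * G x)
      + Re (A * v\<^sup>2 - B * v))"
  proof
    fix x
    have "B * (Z x / N - v) + A * (G x / N\<^sup>2 - 2 * v * (Z x / N) + v\<^sup>2)
        = (B / N - 2 * A * v / N) * Z x + (A / N\<^sup>2) * G x + (A * v\<^sup>2 - B * v)"
      by (simp add: algebra_simps)
    then show "corrected N v A B x = Re ((B / N - 2 * A * v / N) * Z x) + Re ((A / N\<^sup>2) * G x)
        + Re (A * v\<^sup>2 - B * v)"
      unfolding corrected_def by (metis plus_complex.sel(1))
  qed
  show ?thesis unfolding eq
    by (intro harmonic_at_add harmonic_at_const harmonic_at_Re_Z harmonic_at_Re_G)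
qed

text \<open>The only error is A (G x - (Z x)^2) / N^2, which is O(1/N^2) at every vertex and not
  just near v.\<close>

lemma corrected_approx:
  assumes "cmod A \<le> M" "N > 0"
  shows "\<bar>corrected N v A B x - (Re (B * (Z x / N - v)) + Re (A * (Z x / N - v)\<^sup>2))\<bar> \<le> M * C / N\<^sup>2"
proof -
  have "corrected N v A B x - (Re (B * (Z x / N - v)) + Re (A * (Z x / N - v)\<^sup>2))
      = Re (A * ((G x - (Z x)\<^sup>2) / N\<^sup>2))"
    by (simp add: corrected_def algebra_simps power2_eq_square diff_divide_distrib
        flip: plus_complex.sel minus_complex.sel)
  also have "\<bar>\<dots>\<bar> \<le> cmod (A * ((G x - (Z x)\<^sup>2) / N\<^sup>2))" by (rule abs_Re_le_cmod)
  also have "\<dots> = cmod A * cmod (G x - (Z x)\<^sup>2) / N\<^sup>2" by (simp add: norm_mult norm_divide norm_power)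
  also have "\<dots> \<le> M * C / N\<^sup>2"
  proof (intro divide_right_mono mult_mono)
    show "0 \<le> M" using assms(1) norm_ge_zero order_trans by blast
  qed (use assms corrector in auto)
  finally show ?thesis .
qed

text \<open>Half of the loss c0 |z - v|^2 pays for the square in \<open>maximum_principle\<close>;
  the other half is a gain at the exit vertex that beats the error of the corrected quadratic.
  Boundedness of K makes S finite, so the difference of g and W attains its maximum on S.\<close>

lemma comparison:
  fixes W :: "complex \<Rightarrow> real"
  assumes K: "bounded K" and pos: "c0 > 0" "s0 > 0" "\<eta> > 0"
    and W: "\<And>v. v \<in> K \<Longrightarrow> \<exists>A B. cmod A \<le> M \<and> (\<forall>z. cmod (z - v) \<le> s0 \<longrightarrow>
       W z \<le> W v + Re (B * (z - v)) + Re (A * (z - v)\<^sup>2) - c0 * (cmod (z - v))\<^sup>2)"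
  shows "\<forall>\<^sub>F n in sequentially. \<forall>S g. (\<forall>u\<in>S. Z u / of_nat n \<in> K \<and> harmonic_at g u) \<longrightarrow>
     (\<forall>u\<in>S. \<forall>x\<in>{P u, Q u}. x \<notin> S \<longrightarrow> g x \<le> W (Z x / of_nat n)) \<longrightarrow>
     (\<forall>u\<in>S. g u \<le> W (Z u / of_nat n) + \<eta>)"
proof -
  have "(\<lambda>n. 2 * (M * C) / (real n)\<^sup>2) \<longlonglongrightarrow> 0"
    using tendsto_mult[OF lim_const_over_n[of "2 * (M * C)"] lim_const_over_n[of 1]]
    by (simp add: power2_eq_square)
  moreover have "(\<lambda>n. D / real n) \<longlonglongrightarrow> 0" by (rule lim_const_over_n)
  \<comment> \<open>The corrector error, counted once at u and once at the exit vertex, must be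
    below \<eta> and below the gain at distance s0 / 2. A step shorter than s0 / 2 keeps the exit
    vertex of the half ball within s0 of v, where the expansion of W holds.\<close>
  ultimately have ev: "\<forall>\<^sub>F n in sequentially. 2 * (M * C) / (real n)\<^sup>2 < min \<eta> (c0 / 2 * (s0/2)\<^sup>2)"
    "\<forall>\<^sub>F n in sequentially. D / real n < s0 / 2"
    using pos by - (rule order_tendstoD(2), assumption, simp)+
  show ?thesis using ev eventually_gt_at_top[of 0]
  proof eventually_elim
    case (elim n)
    define N where "N = real n"
    have N: "N > 0" using elim by (simp add: N_def)
    have Nn: "(of_nat n :: complex) = of_real N" by (simp add: N_def)
    show ?case unfolding Nn
    proof (intro allI impI)
      fix S g
      assume S: "\<forall>u\<in>S. Z u / N \<in> K \<and> harmonic_at g u"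
        and bd: "\<forall>u\<in>S. \<forall>x\<in>{P u, Q u}. x \<notin> S \<longrightarrow> g x \<le> W (Z x / N)"
      obtain r where r: "\<And>z. z \<in> K \<Longrightarrow> cmod z \<le> r" using K unfolding bounded_iff by blast
      have "S \<subseteq> {u. cmod (Z u) \<le> N * r}"
      proof
        fix u assume "u \<in> S"
        then have "cmod (Z u / N) \<le> r" using S r by blast
        then show "u \<in> {u. cmod (Z u) \<le> N * r}" using N by (simp add: norm_divide field_simps)
      qed
      then have fin: "finite S" using locally_finite finite_subset by blast
      define \<phi> where "\<phi> = (\<lambda>x. g x - W (Z x / N))"
      show "\<forall>u\<in>S. g u \<le> W (Z u / N) + \<eta>"
      proof (rule ccontr)
        assume "\<not> ?thesis"
        then obtain u0 where u0: "u0 \<in> S" "\<phi> u0 > \<eta>" unfolding \<phi>_def by force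
        obtain u where u: "u \<in> S" "\<And>x. x \<in> S \<Longrightarrow> \<phi> x \<le> \<phi> u"
          using obtains_MAX[OF fin, of \<phi>] u0 by (metis empty_iff Max_ge fin finite_imageI imageI)
        have big: "\<phi> u > \<eta>" using u(2)[OF u0(1)] u0(2) by simp
        define v where "v = Z u / N"
        define s where "s = s0 / 2"
        obtain A B where AB: "cmod A \<le> M" "\<And>z. cmod (z - v) \<le> s0 \<Longrightarrow>
             W z \<le> W v + Re (B * (z - v)) + Re (A * (z - v)\<^sup>2) - c0 * (cmod (z - v))\<^sup>2"
          using W S u(1) v_def by blast
        define S' where "S' = {x\<in>S. cmod (Z x / N - v) < s}"
        define h where "h = (\<lambda>x. g x - corrected N v A B x)"
        have "finite S'" "u \<in> S'" using fin u(1) pos by (auto simp: S'_def v_def s_def)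
        moreover have "harmonic_at h x" if "x \<in> S'" for x
          using that S corrected_harmonic unfolding h_def S'_def by (intro harmonic_at_diff) auto
        ultimately obtain x y where xy: "x \<in> S'" "y \<in> {P x, Q x}" "y \<notin> S'"
          "h u + c0 / 2 * (cmod (Z u / N - v))\<^sup>2 \<le> h y + c0 / 2 * (cmod (Z y / N - v))\<^sup>2"
          using maximum_principle[of S' u h N "c0 / 2" v] N pos by auto
        have "cmod (Z y / N - Z x / N) \<le> D / N"
          using xy(2) step[of x] N by (auto simp: norm_divide divide_right_mono simp flip: diff_divide_distrib)
        moreover have "cmod (Z x / N - v) < s" using xy(1) by (simp add: S'_def)
        ultimately have near: "cmod (Z y / N - v) \<le> s0"
          using elim(2)[folded N_def] dist_triangle[of "Z y / N" v "Z x / N", unfolded dist_norm]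
          unfolding s_def by linarith
        have hu: "h u \<ge> g u - M * C / N\<^sup>2"
          using corrected_approx[OF AB(1) N, of v B u] by (simp add: h_def v_def)
        have "h y \<le> g y - (Re (B * (Z y / N - v)) + Re (A * (Z y / N - v)\<^sup>2)) + M * C / N\<^sup>2"
          using corrected_approx[OF AB(1) N, of v B y] by (simp add: h_def)
        also have "\<dots> \<le> g y + W v - W (Z y / N) - c0 * (cmod (Z y / N - v))\<^sup>2 + M * C / N\<^sup>2"
          using AB(2)[OF near] by simp
        finally have hy: "h y \<le> \<phi> y + W v - c0 * (cmod (Z y / N - v))\<^sup>2 + M * C / N\<^sup>2"
          by (simp add: \<phi>_def)
        have "h u \<le> h y + c0 / 2 * (cmod (Z y / N - v))\<^sup>2" using xy(4) by (simp add: v_def)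
        with hu hy have key: "\<phi> u \<le> \<phi> y - c0 / 2 * (cmod (Z y / N - v))\<^sup>2 + 2 * (M * C) / N\<^sup>2"
        proof -
          define e where "e = M * C / N\<^sup>2"
          define X where "X = c0 / 2 * (cmod (Z y / N - v))\<^sup>2"
          have "2 * (M * C) / N\<^sup>2 = 2 * e" "c0 * (cmod (Z y / N - v))\<^sup>2 = 2 * X"
            "\<phi> u = g u - W v"
            by (simp_all add: e_def X_def \<phi>_def v_def)
          with hu hy \<open>h u \<le> h y + _\<close> show ?thesis
            unfolding e_def[symmetric] X_def[symmetric] by argo
        qed
        have small: "2 * (M * C) / N\<^sup>2 < \<eta>" "2 * (M * C) / N\<^sup>2 < c0 / 2 * s\<^sup>2"
          using elim(1) by (simp_all add: N_def s_def)
        \<comment> \<open>Either y is in S at distance at least s from v, and the quadratic gain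
          contradicts the maximality of u, or y is outside S, where the boundary assumption gives
          \<phi> y \<le> 0.\<close>
        show False
        proof (cases "y \<in> S")
          case True
          then have "s \<le> cmod (Z y / N - v)" using xy(3) by (simp add: S'_def)
          then have "s\<^sup>2 \<le> (cmod (Z y / N - v))\<^sup>2" using pos by (intro power_mono) (auto simp: s_def)
          then have "c0 / 2 * s\<^sup>2 \<le> c0 / 2 * (cmod (Z y / N - v))\<^sup>2" using pos by simp
          then show False using key small u(2)[OF True] by linarith
        next
          case False
          then have "\<phi> y \<le> 0" using bd xy(1,2) unfolding \<phi>_def S'_def by fastforce
          moreover have "0 \<le> c0 / 2 * (cmod (Z y / N - v))\<^sup>2" using pos by simp
          ultimately show False using key small big by linarith
        qed
      qed
    qed
  qed
qed

end

section \<open>The T-graph\<close>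

locale tgraph =
  fixes lam :: complex and a b c :: real and \<alpha> \<beta> \<gamma> :: complex
  assumes lam: "cmod lam = 1" and triangle: "unit_area_triangle a b c \<alpha> \<beta> \<gamma>"
begin

abbreviation \<psi> where "\<psi> \<equiv> psi lam a b c \<alpha> \<beta> \<gamma>"
abbreviation f where "f \<equiv> f_Delta \<alpha> \<beta> \<gamma>"
abbreviation g where "g \<equiv> g_Delta \<alpha> \<beta> \<gamma>"

definition R :: "int \<Rightarrow> int \<Rightarrow> real" where "R m n = Re (cnj lam * cnj (f m n))"
text \<open>The factor 1/2 is the constant term of Re (cnj w) w = (1 + w^2) / 2 for unit w, so
  \<open>p\<close> and \<open>q\<close> are the constant parts of the increments of \<psi> in m and
  n. The sign of \<open>q\<close> reflects that the side c \<gamma> runs from u(m,n+1) to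
  u(m,n).\<close>

definition p :: complex where "p = of_real a * \<alpha> / 2"
definition q :: complex where "q = - of_real c * \<gamma> / 2"
definition \<xi> :: complex where "\<xi> = \<beta> / \<gamma>"
definition \<upsilon> :: complex where "\<upsilon> = \<beta> / \<alpha>"
definition E :: "int \<Rightarrow> int \<Rightarrow> complex" where "E m n = (f m n)\<^sup>2"
definition L :: "int \<Rightarrow> int \<Rightarrow> complex" where "L m n = p * of_int m + q * of_int n"
text \<open>Determined by requiring that \<kappa> E have the increment lam^2 p E in the direction of
  m.\<close>

definition \<kappa> :: complex where "\<kappa> = lam\<^sup>2 * p / (\<xi>\<^sup>2 - 1)"

section \<open>Relations between the sides of the triangle\<close>

lemma triangleD:
  "0 < a" "0 < b" "0 < c" "cmod \<alpha> = 1" "cmod \<beta> = 1" "cmod \<gamma> = 1" "\<alpha> \<noteq> 0" "\<beta> \<noteq> 0" "\<gamma> \<noteq> 0"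
  "of_real a * \<alpha> + of_real b * \<beta> + of_real c * \<gamma> = 0" "0 < Im (cnj \<alpha> * \<beta>)"
  using triangle by (auto simp: unit_area_triangle_def)

lemma cnj_unit: "cmod z = 1 \<Longrightarrow> cnj z * z = 1"
  by (metis complex_norm_square mult.commute of_real_1 one_power2)

text \<open>Multiplying the closing relation by the conjugate of one side and taking imaginary parts
  transfers the orientation of one pair of sides to the others.\<close>

lemma Im_products: "Im (cnj \<beta> * \<gamma>) > 0" "Im (cnj \<alpha> * \<gamma>) < 0"
proof -
  have "cnj \<beta> * (of_real a * \<alpha> + of_real b * \<beta> + of_real c * \<gamma>) = 0" using triangleD by simp
  then have "of_real a * (cnj \<beta> * \<alpha>) + of_real b + of_real c * (cnj \<beta> * \<gamma>) = 0"
    using cnj_unit[OF triangleD(5)] by (simp only: distrib_left mult.left_commute[of "cnj \<beta>"]) simp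
  then have "a * Im (cnj \<beta> * \<alpha>) + c * Im (cnj \<beta> * \<gamma>) = 0" by (simp add: complex_eq_iff)
  moreover have "Im (cnj \<beta> * \<alpha>) = - Im (cnj \<alpha> * \<beta>)" by simp
  ultimately have "c * Im (cnj \<beta> * \<gamma>) = a * Im (cnj \<alpha> * \<beta>)" by (simp only: mult_minus_right)
  then show "Im (cnj \<beta> * \<gamma>) > 0" using triangleD(1,3,11) by (metis mult_pos_pos zero_less_mult_pos)
  have "cnj \<alpha> * (of_real a * \<alpha> + of_real b * \<beta> + of_real c * \<gamma>) = 0" using triangleD by simp
  then have "of_real a + of_real b * (cnj \<alpha> * \<beta>) + of_real c * (cnj \<alpha> * \<gamma>) = 0"
    using cnj_unit[OF triangleD(4)] by (simp only: distrib_left mult.left_commute[of "cnj \<alpha>"]) simp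
  then have "b * Im (cnj \<alpha> * \<beta>) + c * Im (cnj \<alpha> * \<gamma>) = 0" by (simp add: complex_eq_iff)
  moreover have "b * Im (cnj \<alpha> * \<beta>) > 0" using triangleD(2,11) by (rule mult_pos_pos)
  ultimately show "Im (cnj \<alpha> * \<gamma>) < 0" using triangleD(3)
    by (smt (verit) mult_nonneg_nonneg)
qed

lemma xi_sq: "\<xi>\<^sup>2 \<noteq> 1"
proof
  assume "\<xi>\<^sup>2 = 1"
  then have "\<xi> = 1 \<or> \<xi> = -1" by (simp add: power2_eq_1_iff)
  then have "\<beta> = \<gamma> \<or> \<beta> = - \<gamma>" using triangleD by (auto simp: \<xi>_def field_simps)
  then show False using Im_products(1) by auto
qed

text \<open>This is the closing relation combined with its conjugate, in which the unit numbers
  become their reciprocals. It is the compatibility condition that lets a single \<kappa> serve both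
  lattice directions.\<close>

lemma p_q: "q * (\<xi>\<^sup>2 - 1) = p * (\<upsilon>\<^sup>2 - 1)"
proof -
  have cl: "of_real a * \<alpha> + of_real c * \<gamma> = - of_real b * \<beta>"
    using triangleD(10) by (simp add: eq_neg_iff_add_eq_0 algebra_simps)
  have "cnj (of_real a * \<alpha> + of_real b * \<beta> + of_real c * \<gamma>) = 0"
    using triangleD(10) by simp
  moreover have "cnj \<alpha> = 1 / \<alpha>" "cnj \<beta> = 1 / \<beta>" "cnj \<gamma> = 1 / \<gamma>"
    using cnj_unit triangleD by (simp_all add: field_simps)
  ultimately have cl': "of_real a / \<alpha> + of_real c / \<gamma> = - of_real b / \<beta>"
    by (simp add: eq_neg_iff_add_eq_0 algebra_simps)
  have "2 * (p * (\<upsilon>\<^sup>2 - 1) - q * (\<xi>\<^sup>2 - 1))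
      = \<beta>\<^sup>2 * (of_real a / \<alpha> + of_real c / \<gamma>) - (of_real a * \<alpha> + of_real c * \<gamma>)"
    using triangleD(7-9) by (simp add: p_def q_def \<xi>_def \<upsilon>_def field_simps power2_eq_square)
  also have "\<dots> = 0" unfolding cl cl' using triangleD(8) by (simp add: power2_eq_square)
  finally show ?thesis by simp
qed

lemma kappa: "\<kappa> * (\<xi>\<^sup>2 - 1) = lam\<^sup>2 * p" "\<kappa> * (\<upsilon>\<^sup>2 - 1) = lam\<^sup>2 * q"
proof -
  show 1: "\<kappa> * (\<xi>\<^sup>2 - 1) = lam\<^sup>2 * p" using xi_sq by (simp add: \<kappa>_def)
  have "(\<xi>\<^sup>2 - 1) * (\<kappa> * (\<upsilon>\<^sup>2 - 1)) = (\<xi>\<^sup>2 - 1) * (lam\<^sup>2 * q)"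
    using 1 p_q by (metis mult.assoc mult.commute)
  then show "\<kappa> * (\<upsilon>\<^sup>2 - 1) = lam\<^sup>2 * q" using xi_sq by simp
qed

text \<open>Real linear independence of \<open>p\<close> and \<open>q\<close>; it yields both local
  finiteness and the removal of the linear part of the corrector.\<close>

lemma Im_p_q: "Im (cnj p * q) \<noteq> 0"
proof -
  have "cnj p * q = of_real (- a * c / 4) * (cnj \<alpha> * \<gamma>)" by (simp add: p_def q_def)
  then have "Im (cnj p * q) = - a * c / 4 * Im (cnj \<alpha> * \<gamma>)" by (simp add: Im_complex_of_real)
  then show ?thesis using Im_products(2) triangleD(1,3) by simp
qed

section \<open>Explicit form of \<psi>\<close>

lemma f_step: "f (m+1) n = \<xi> * f m n" "f m (n+1) = \<upsilon> * f m n"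
  using triangleD by (simp_all add: f_Delta_def \<xi>_def \<upsilon>_def power_int_add field_simps)

lemma E_step: "E (m+1) n = \<xi>\<^sup>2 * E m n" "E m (n+1) = \<upsilon>\<^sup>2 * E m n"
  by (simp_all add: E_def f_step power_mult_distrib)

lemma L_step: "L (m+1) n = L m n + p" "L m (n+1) = L m n + q"
  by (simp_all add: L_def algebra_simps)

lemma norm_f: "cmod (f m n) = 1"
  using triangleD by (simp add: f_Delta_def norm_mult norm_power_int norm_divide)

lemma norm_E: "cmod (E m n) = 1"
  by (simp add: E_def norm_power norm_f)

lemma g_conv: "g m n = \<alpha> * f m n" and g_step: "g (m-1) (n+1) = \<gamma> / \<alpha> * g m n"
  using triangleD
  by (simp_all add: g_Delta_def f_Delta_def power_int_add power_int_diff field_simps)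

lemma psi: "is_psi lam a b c \<alpha> \<beta> \<gamma> \<psi>"
  unfolding psi_def using theI'[OF ex1_is_psi[OF triangle lam]] .

lemma psi_edges:
  "\<psi> 0 0 = 0" "\<psi> (m+1) n - \<psi> m n = of_real (a * R m n) * (lam * g m n)"
  "\<psi> m (n+1) - \<psi> (m+1) n = of_real (b * R m n) * (lam * g m (n+1))"
  "\<psi> m n - \<psi> m (n+1) = of_real (c * R m n) * (lam * g (m-1) (n+1))"
  using psi by (simp_all add: is_psi_def Let_def R_def)

lemma R_lam_g: "of_real (R m n) * (lam * g m n) = \<alpha> / 2 * (1 + lam\<^sup>2 * E m n)"
proof -
  define w where "w = lam * f m n"
  have "cnj w * w = 1" by (rule cnj_unit) (simp add: w_def norm_mult lam norm_f)
  moreover have "of_real (R m n) = (w + cnj w) / 2"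
    unfolding complex_add_cnj by (simp add: R_def w_def)
  ultimately have Rw: "of_real (R m n) * w = (1 + w\<^sup>2) / 2"
    by (simp add: power2_eq_square algebra_simps)
  have "of_real (R m n) * (lam * g m n) = \<alpha> * (of_real (R m n) * w)"
    by (simp only: g_conv w_def mult_ac)
  then show ?thesis unfolding Rw by (simp add: w_def E_def power_mult_distrib)
qed

lemma psi_step:
  "\<psi> (m+1) n - \<psi> m n = p * (1 + lam\<^sup>2 * E m n)"
  "\<psi> m (n+1) - \<psi> m n = q * (1 + lam\<^sup>2 * E m n)"
proof -
  have "\<psi> (m+1) n - \<psi> m n = of_real a * (of_real (R m n) * (lam * g m n))"
    by (simp add: psi_edges)
  then show "\<psi> (m+1) n - \<psi> m n = p * (1 + lam\<^sup>2 * E m n)"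
    unfolding R_lam_g by (simp add: p_def)
  have "\<psi> m (n+1) - \<psi> m n = - of_real c * \<gamma> / \<alpha> * (of_real (R m n) * (lam * g m n))"
    using psi_edges(4)[of m n] unfolding g_step by (simp add: algebra_simps)
  then show "\<psi> m (n+1) - \<psi> m n = q * (1 + lam\<^sup>2 * E m n)"
    unfolding R_lam_g using triangleD(7) by (simp add: q_def)
qed

text \<open>Both sides vanish at the origin, and \<open>kappa\<close> turns the increments of
  \<kappa> E into the oscillating parts in \<open>psi_step\<close>.\<close>

lemma psi_explicit: "\<psi> m n = L m n + \<kappa> * (E m n - 1)"
proof -
  have E0: "E 0 0 = 1" "L 0 0 = 0" by (simp_all add: E_def L_def f_Delta_def)
  have col: "\<psi> m 0 = L m 0 + \<kappa> * (E m 0 - 1)" for m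
  proof (rule int_fun_eqI[where f = "\<lambda>m. \<psi> m 0" and g = "\<lambda>m. L m 0 + \<kappa> * (E m 0 - 1)"])
    fix k
    have "L (k+1) 0 + \<kappa> * (E (k+1) 0 - 1) - (L k 0 + \<kappa> * (E k 0 - 1))
        = p + \<kappa> * (\<xi>\<^sup>2 - 1) * E k 0"
      unfolding L_step E_step by (simp add: algebra_simps)
    then show "\<psi> (k+1) 0 - \<psi> k 0 =
        L (k+1) 0 + \<kappa> * (E (k+1) 0 - 1) - (L k 0 + \<kappa> * (E k 0 - 1))"
      unfolding kappa psi_step by (simp add: algebra_simps)
  qed (simp add: E0 psi_edges)
  show ?thesis
  proof (rule int_fun_eqI[where f = "\<psi> m" and g = "\<lambda>n. L m n + \<kappa> * (E m n - 1)"])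
    fix k
    have "L m (k+1) + \<kappa> * (E m (k+1) - 1) - (L m k + \<kappa> * (E m k - 1))
        = q + \<kappa> * (\<upsilon>\<^sup>2 - 1) * E m k"
      unfolding L_step E_step by (simp add: algebra_simps)
    then show "\<psi> m (k+1) - \<psi> m k =
        L m (k+1) + \<kappa> * (E m (k+1) - 1) - (L m k + \<kappa> * (E m k - 1))"
      unfolding kappa psi_step by (simp add: algebra_simps)
  qed (rule col)
qed

section \<open>The bounded corrector of the square\<close>

lemma affine_on_black_psi: "affine_on_black a b c R \<psi>"
  unfolding affine_on_black_def
proof (intro allI exI conjI)
  fix m n
  show "\<psi> (m+1) n - \<psi> m n = of_real (a * R m n) * (lam * g m n)"
    "\<psi> m n - \<psi> (m+1) (n-1) = of_real (b * R m (n-1)) * (lam * g m n)"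
    "\<psi> (m+1) (n-1) - \<psi> (m+1) n = of_real (c * R (m+1) (n-1)) * (lam * g m n)"
    using psi_edges(2)[of m n] psi_edges(3)[of m "n-1"] psi_edges(4)[of "m+1" "n-1"] by simp_all
qed

text \<open>The integral of \<open>L d\<psi>\<close>, where \<open>L m n\<close> is the slope on the black face \<open>b(m,n)\<close>.  It is
  consistent around white faces because \<open>g_Delta\<close> times \<open>L\<close> lies in the kernel of \<open>K\<close>.\<close>

definition F :: "int \<Rightarrow> int \<Rightarrow> complex" where
  "F m n = (L m n)\<^sup>2 / 2 + \<kappa> * E m n * L m n - p\<^sup>2 / 2 * of_int m + (q\<^sup>2 / 2 - p * q) * of_int n
     - \<kappa> * \<xi>\<^sup>2 * p / (\<xi>\<^sup>2 - 1) * E m n"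

text \<open>The edge from u(m,n) to u(m+1,n) lies on b(m,n), and the edge from u(m,n) to u(m,n+1)
  lies on b(m-1,n+1), where the slope factor L equals L m n - p + q. The last term of
  \<open>F\<close> absorbs the cross term of the product rule for \<kappa> E L in m; by
  \<open>p_q\<close> the same coefficient works in n.\<close>

lemma F_step:
  "F (m+1) n - F m n = L m n * (\<psi> (m+1) n - \<psi> m n)"
  "F m (n+1) - F m n = (L m n - p + q) * (\<psi> m (n+1) - \<psi> m n)"
proof -
  define d where "d = \<kappa> * \<xi>\<^sup>2 * p / (\<xi>\<^sup>2 - 1)"
  have d: "d * (\<xi>\<^sup>2 - 1) = \<kappa> * \<xi>\<^sup>2 * p" using xi_sq by (simp add: d_def)
  have d': "d * (\<upsilon>\<^sup>2 - 1) = \<kappa> * \<upsilon>\<^sup>2 * q - (q - p) * \<kappa> * (\<upsilon>\<^sup>2 - 1)"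
  proof -
    have "(\<xi>\<^sup>2 - 1) * (d * (\<upsilon>\<^sup>2 - 1)) = \<kappa> * \<xi>\<^sup>2 * (p * (\<upsilon>\<^sup>2 - 1))"
      using d by (metis mult.assoc mult.commute)
    also have "\<dots> = \<kappa> * \<xi>\<^sup>2 * (q * (\<xi>\<^sup>2 - 1))" by (simp add: p_q)
    finally have "d * (\<upsilon>\<^sup>2 - 1) = \<kappa> * \<xi>\<^sup>2 * q" using xi_sq by simp
    also have "\<dots> = \<kappa> * \<upsilon>\<^sup>2 * q - (q - p) * \<kappa> * (\<upsilon>\<^sup>2 - 1)"
    proof -
      have "\<kappa> * \<upsilon>\<^sup>2 * q - (q - p) * \<kappa> * (\<upsilon>\<^sup>2 - 1) = \<kappa> * (q + p * (\<upsilon>\<^sup>2 - 1))"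
        by (simp add: algebra_simps)
      then show ?thesis unfolding p_q[symmetric] by (simp add: algebra_simps)
    qed
    finally show ?thesis .
  qed
  have "F (m+1) n - F m n = L m n * (p + \<kappa> * (\<xi>\<^sup>2 - 1) * E m n)
      + (\<kappa> * \<xi>\<^sup>2 * p - d * (\<xi>\<^sup>2 - 1)) * E m n"
    unfolding F_def d_def[symmetric] L_step E_step
    by (simp add: field_simps power2_eq_square)
  then show "F (m+1) n - F m n = L m n * (\<psi> (m+1) n - \<psi> m n)"
    unfolding d kappa psi_step by (simp add: algebra_simps)
  have "F m (n+1) - F m n = (L m n - p + q) * (q + \<kappa> * (\<upsilon>\<^sup>2 - 1) * E m n)
      + (\<kappa> * \<upsilon>\<^sup>2 * q - (q - p) * \<kappa> * (\<upsilon>\<^sup>2 - 1) - d * (\<upsilon>\<^sup>2 - 1)) * E m n"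
    unfolding F_def d_def[symmetric] L_step E_step
    by (simp add: field_simps power2_eq_square)
  then show "F m (n+1) - F m n = (L m n - p + q) * (\<psi> m (n+1) - \<psi> m n)"
    unfolding d' kappa psi_step by (simp add: algebra_simps)
qed

text \<open>\<open>F_step\<close> covers two sides of the black face directly. The third, from
  u(m+1,n-1) to u(m,n), is reached through u(m,n-1), around the white face w(m,n-1); the slopes
  agree because the two increments of \<psi> there are in the ratio p : q.\<close>

lemma affine_on_black_F: "affine_on_black a b c R F"
  unfolding affine_on_black_def
proof (intro allI)
  fix m n
  obtain s where s: "\<psi> (m+1) n - \<psi> m n = of_real (a * R m n) * s"
    "\<psi> m n - \<psi> (m+1) (n-1) = of_real (b * R m (n-1)) * s"
    "\<psi> (m+1) (n-1) - \<psi> (m+1) n = of_real (c * R (m+1) (n-1)) * s"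
    using affine_on_black_psi unfolding affine_on_black_def by meson
  have L: "L m n = L m (n-1) + q" "L (m+1) (n-1) = L m n - q + p"
    using L_step(2)[of m "n-1"] L_step(1)[of m "n-1"] by simp_all
  have "F m n - F (m+1) (n-1) = (F m n - F m (n-1)) - (F (m+1) (n-1) - F m (n-1))" by simp
  also have "\<dots> = (L m (n-1) - p + q) * (\<psi> m n - \<psi> m (n-1))
      - L m (n-1) * (\<psi> (m+1) (n-1) - \<psi> m (n-1))"
    using F_step(1)[of m "n-1"] F_step(2)[of m "n-1"] by simp
  also have "\<dots> = L m n * (\<psi> m n - \<psi> (m+1) (n-1))"
  proof -
    have "p * (\<psi> m n - \<psi> m (n-1)) = q * (\<psi> (m+1) (n-1) - \<psi> m (n-1))"
      using psi_step(1)[of m "n-1"] psi_step(2)[of m "n-1"] by simp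
    then show ?thesis unfolding L(1) by (simp add: algebra_simps)
  qed
  finally have e2: "F m n - F (m+1) (n-1) = L m n * (\<psi> m n - \<psi> (m+1) (n-1))" .
  have "F (m+1) n - F (m+1) (n-1) = L m n * (\<psi> (m+1) n - \<psi> (m+1) (n-1))"
    using F_step(2)[of "m+1" "n-1"] L(2) by simp
  then have e3: "F (m+1) (n-1) - F (m+1) n = L m n * (\<psi> (m+1) (n-1) - \<psi> (m+1) n)"
    by (simp add: algebra_simps)
  show "\<exists>\<sigma>. F (m+1) n - F m n = of_real (a * R m n) * \<sigma> \<and>
     F m n - F (m+1) (n-1) = of_real (b * R m (n-1)) * \<sigma> \<and>
     F (m+1) (n-1) - F (m+1) n = of_real (c * R (m+1) (n-1)) * \<sigma>"
    unfolding F_step(1) e2 e3 s by (intro exI[of _ "L m n * s"]) simp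
qed

text \<open>\<^term>\<open>2 * F m n - (\<psi> m n)\<^sup>2\<close> grows only linearly, and its linear part can be removed
  because \<open>\<psi>\<close> and \<open>cnj \<circ> \<psi>\<close> are affine on black faces.\<close>

lemma corrector_exists:
  "\<exists>G C. affine_on_black a b c R G \<and> (\<forall>m n. cmod (G m n - (\<psi> m n)\<^sup>2) \<le> C)"
proof -
  define \<Delta> where "\<Delta> = p * cnj q - q * cnj p"
  define \<mu> where "\<mu> = - p\<^sup>2 / 2"
  define \<nu> where "\<nu> = q\<^sup>2 / 2 - p * q"
  \<comment> \<open>Cramer's rule for writing the linear part \<mu> m + \<nu> n of \<open>F\<close>
    as t L + t' cnj L.\<close>
  define t where "t = (\<mu> * cnj q - \<nu> * cnj p) / \<Delta>"
  define t' where "t' = (\<nu> * p - \<mu> * q) / \<Delta>"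
  have "Im \<Delta> = - 2 * Im (cnj p * q)" by (simp add: \<Delta>_def)
  then have \<Delta>: "\<Delta> \<noteq> 0" using Im_p_q by auto
  have "t * p + t' * cnj p = (\<mu> * \<Delta>) / \<Delta>" "t * q + t' * cnj q = (\<nu> * \<Delta>) / \<Delta>"
    by (simp_all add: t_def t'_def \<Delta>_def add_divide_distrib[symmetric] algebra_simps)
  then have tp: "t * p + t' * cnj p = \<mu>" "t * q + t' * cnj q = \<nu>" using \<Delta> by simp_all
  define d where "d = \<kappa> * \<xi>\<^sup>2 * p / (\<xi>\<^sup>2 - 1)"
  \<comment> \<open>2 F contains 2 \<kappa> E L, but the square of \<psi> only 2 \<kappa> (E - 1) L;
    the additional \<kappa> next to t removes the difference 2 \<kappa> L up to a bounded
    term.\<close>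
  define G where "G = (\<lambda>m n. 2 * F m n + ((- 2 * (t + \<kappa>)) * \<psi> m n + (- 2 * t') * cnj (\<psi> m n)))"
  have "affine_on_black a b c R G"
    unfolding G_def by (intro affine_on_black_add affine_on_black_cmult affine_on_black_cnj
        affine_on_black_psi affine_on_black_F)
  moreover have "cmod (G m n - (\<psi> m n)\<^sup>2) \<le>
      2 * cmod d + cmod (2 * (t + \<kappa>) * \<kappa>) * 2 + cmod (2 * t' * cnj \<kappa>) * 2 + (cmod \<kappa>)\<^sup>2 * 4" for m n
  proof -
    define e where "e = E m n - 1"
    have ne: "cmod e \<le> 2"
      using norm_triangle_ineq4[of "E m n" 1] by (simp add: e_def norm_E)
    have T: "t * L m n + t' * cnj (L m n) = \<mu> * of_int m + \<nu> * of_int n"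
      unfolding tp[symmetric] by (simp add: L_def algebra_simps)
    have F': "2 * F m n = (L m n)\<^sup>2 + 2 * \<kappa> * (e + 1) * L m n + 2 * (t * L m n + t' * cnj (L m n))
        - 2 * d * E m n"
      unfolding T by (simp add: F_def e_def \<mu>_def \<nu>_def d_def algebra_simps)
    have "G m n - (\<psi> m n)\<^sup>2 = - 2 * d * E m n - 2 * (t + \<kappa>) * \<kappa> * e - 2 * t' * cnj \<kappa> * cnj e - (\<kappa> * e)\<^sup>2"
      unfolding G_def F' psi_explicit e_def[symmetric]
      by (simp add: algebra_simps power2_eq_square)
    also have "cmod \<dots> \<le> cmod (- 2 * d * E m n) + cmod (2 * (t + \<kappa>) * \<kappa> * e)
        + cmod (2 * t' * cnj \<kappa> * cnj e) + cmod ((\<kappa> * e)\<^sup>2)"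
      by (intro order_trans[OF norm_triangle_ineq4] add_mono order_refl)
    also have "\<dots> = 2 * cmod d + cmod (2 * (t + \<kappa>) * \<kappa>) * cmod e + cmod (2 * t' * cnj \<kappa>) * cmod e
        + (cmod \<kappa>)\<^sup>2 * (cmod e)\<^sup>2"
      by (simp add: norm_mult norm_E norm_power power_mult_distrib)
    also have "\<dots> \<le> 2 * cmod d + cmod (2 * (t + \<kappa>) * \<kappa>) * 2 + cmod (2 * t' * cnj \<kappa>) * 2
        + (cmod \<kappa>)\<^sup>2 * 2\<^sup>2"
      using ne by (intro add_mono mult_left_mono power_mono) auto
    finally show ?thesis by simp
  qed
  ultimately show ?thesis by blast
qed

text \<open>\<psi> stays within 2 |\<kappa>| of L, and m and n are recovered from L by pairing with
  \<open>q\<close> and \<open>p\<close>, up to the nonzero determinant J.\<close>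

lemma locally_finite: "finite {u. cmod (case u of (m, n) \<Rightarrow> \<psi> m n) \<le> r}"
proof -
  define J where "J = Im (cnj p * q)"
  define I where "I = \<bar>J\<bar>"
  have I: "I > 0" using Im_p_q by (simp add: I_def J_def)
  define k where "k = (cmod p + cmod q) * (r + 2 * cmod \<kappa>) / I"
  have "\<bar>real_of_int m\<bar> \<le> k \<and> \<bar>real_of_int n\<bar> \<le> k" if le: "cmod (\<psi> m n) \<le> r" for m n
  proof -
    have "cmod (E m n - 1) \<le> 2"
      using norm_triangle_ineq4[of "E m n" 1] by (simp add: norm_E)
    then have "cmod (\<kappa> * (E m n - 1)) \<le> cmod \<kappa> * 2"
      unfolding norm_mult by (intro mult_left_mono) auto
    moreover have "cmod (L m n) \<le> cmod (\<psi> m n) + cmod (\<kappa> * (E m n - 1))"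
      using norm_triangle_ineq4[of "\<psi> m n" "\<kappa> * (E m n - 1)"] by (simp add: psi_explicit)
    ultimately have Lb: "cmod (L m n) \<le> r + 2 * cmod \<kappa>" using le by linarith
    have bd: "\<bar>Im (cnj z * L m n)\<bar> \<le> (cmod p + cmod q) * (r + 2 * cmod \<kappa>)"
      if "z = p \<or> z = q" for z
    proof -
      have "\<bar>Im (cnj z * L m n)\<bar> \<le> cmod (cnj z * L m n)" by (rule abs_Im_le_cmod)
      also have "\<dots> = cmod z * cmod (L m n)" by (simp add: norm_mult)
      also have "\<dots> \<le> (cmod p + cmod q) * (r + 2 * cmod \<kappa>)"
        using that Lb by (intro mult_mono) auto
      finally show ?thesis .
    qed
    have "Im (cnj p * L m n) = J * real_of_int n" "Im (cnj q * L m n) = - J * real_of_int m"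
      by (simp_all add: L_def J_def algebra_simps)
    then have "I * \<bar>real_of_int n\<bar> \<le> (cmod p + cmod q) * (r + 2 * cmod \<kappa>)"
      "I * \<bar>real_of_int m\<bar> \<le> (cmod p + cmod q) * (r + 2 * cmod \<kappa>)"
      using bd[of p] bd[of q] by (simp_all only: I_def abs_mult abs_minus_cancel simp_thms)
    then show ?thesis using I by (simp add: k_def field_simps)
  qed
  then have "{u. cmod (case u of (m, n) \<Rightarrow> \<psi> m n) \<le> r} \<subseteq> {-\<lceil>k\<rceil>..\<lceil>k\<rceil>} \<times> {-\<lceil>k\<rceil>..\<lceil>k\<rceil>}"
    by (fastforce simp: le_ceiling_iff minus_le_iff abs_le_iff ceiling_le_iff intro: le_of_int_ceiling)
  then show ?thesis by (rule finite_subset) simp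
qed

section \<open>Segments through the vertices of a non-degenerate T-graph\<close>

lemma R_nz:
  assumes "nondegenerate \<psi>"
  shows "R m n \<noteq> 0"
proof
  assume "R m n = 0"
  then have "\<psi> (m+1) n = \<psi> m n" "\<psi> m (n+1) = \<psi> m n"
    using psi_edges(2,4)[of m n] by simp_all
  then have "white_face \<psi> m n = {\<psi> m n}" by (simp add: white_face_def)
  moreover have "white_face \<psi> m n \<in> faces \<psi>" by (auto simp: faces_def)
  ultimately show False using assms unfolding nondegenerate_def by blast
qed

lemma norm_edge:
  assumes "u \<in> {(m, n), (m+1, n), (m+1, n-1)}" "v \<in> {(m, n), (m+1, n), (m+1, n-1)}"
  shows "cmod (case_prod \<psi> u - case_prod \<psi> v) \<le> a + b + c"
    and "nondegenerate \<psi> \<Longrightarrow> u \<noteq> v \<Longrightarrow> case_prod \<psi> u \<noteq> case_prod \<psi> v"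
proof -
  have lg: "cmod (lam * g i j) = 1" for i j
    by (simp add: norm_mult lam g_conv norm_f triangleD)
  have R: "\<bar>R i j\<bar> \<le> 1" for i j
    using abs_Re_le_cmod[of "cnj lam * cnj (f i j)"] by (simp add: R_def norm_mult lam norm_f)
  have k: "k * \<bar>R i j\<bar> \<le> k" if "0 < k" for k i j using R[of i j] that by (simp add: mult_left_le)
  have e: "\<psi> (m+1) n - \<psi> m n = of_real (a * R m n) * (lam * g m n)"
    "\<psi> m n - \<psi> (m+1) (n-1) = of_real (b * R m (n-1)) * (lam * g m n)"
    "\<psi> (m+1) (n-1) - \<psi> (m+1) n = of_real (c * R (m+1) (n-1)) * (lam * g m n)"
    using psi_edges(2)[of m n] psi_edges(3)[of m "n-1"] psi_edges(4)[of "m+1" "n-1"] by simp_all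
  have n: "cmod (\<psi> (m+1) n - \<psi> m n) = a * \<bar>R m n\<bar>"
    "cmod (\<psi> m n - \<psi> (m+1) (n-1)) = b * \<bar>R m (n-1)\<bar>"
    "cmod (\<psi> (m+1) (n-1) - \<psi> (m+1) n) = c * \<bar>R (m+1) (n-1)\<bar>"
    unfolding e norm_mult[of _ "lam * _"] lg norm_of_real
    using triangleD(1-3) by (simp_all add: abs_mult)
  have "cmod (\<psi> (m+1) n - \<psi> m n) \<le> a + b + c"
    "cmod (\<psi> m n - \<psi> (m+1) (n-1)) \<le> a + b + c"
    "cmod (\<psi> (m+1) (n-1) - \<psi> (m+1) n) \<le> a + b + c"
    using k[OF triangleD(1), of m n] k[OF triangleD(2), of m "n-1"]
      k[OF triangleD(3), of "m+1" "n-1"] triangleD(1-3) unfolding n by linarith+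
  then show "cmod (case_prod \<psi> u - case_prod \<psi> v) \<le> a + b + c"
    using assms triangleD(1-3) by (auto simp: norm_minus_commute)
  assume "nondegenerate \<psi>" "u \<noteq> v"
  note R_nz[OF this(1)]
  then have "a * \<bar>R m n\<bar> \<noteq> 0" "b * \<bar>R m (n-1)\<bar> \<noteq> 0" "c * \<bar>R (m+1) (n-1)\<bar> \<noteq> 0"
    using triangleD(1-3) by auto
  then have "\<psi> (m+1) n \<noteq> \<psi> m n" "\<psi> m n \<noteq> \<psi> (m+1) (n-1)" "\<psi> (m+1) (n-1) \<noteq> \<psi> (m+1) n"
    using n by (metis diff_self norm_zero)+
  then show "case_prod \<psi> u \<noteq> case_prod \<psi> v"
    using assms \<open>u \<noteq> v\<close> by auto
qed

text \<open>The neighbours of an index are the other two corners of the black face from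
  \<open>black_middle\<close>. The same weight serves \<psi> and the corrector, as both are affine
  on that face.\<close>

lemma balanced:
  assumes "nondegenerate \<psi>"
  shows "\<exists>G P Q t C. balanced_graph (case_prod \<psi>) G P Q t C (a + b + c) \<and>
    (\<forall>u. splits \<psi> (case_prod \<psi> u) (case_prod \<psi> (P u)) (case_prod \<psi> (Q u)))"
proof -
  obtain G C where G: "affine_on_black a b c R G" "\<And>m n. cmod (G m n - (\<psi> m n)\<^sup>2) \<le> C"
    using corrector_exists by blast
  have "\<exists>v w t. 0 < t \<and> t < 1 \<and> case_prod \<psi> v \<noteq> case_prod \<psi> w \<and>
      case_prod \<psi> u = of_real (1 - t) * case_prod \<psi> v + of_real t * case_prod \<psi> w \<and>
      case_prod G u = of_real (1 - t) * case_prod G v + of_real t * case_prod G w \<and>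
      cmod (case_prod \<psi> v - case_prod \<psi> u) \<le> a + b + c \<and> cmod (case_prod \<psi> w - case_prod \<psi> u) \<le> a + b + c \<and>
      splits \<psi> (case_prod \<psi> u) (case_prod \<psi> v) (case_prod \<psi> w)" for u
  proof -
    obtain m n where u: "u = (m, n)" by fastforce
    obtain i j k l m' n' t where t: "0 < t" "t < 1"
      and face: "{(m, n), (i, j), (k, l)} = {(m', n'), (m'+1, n'), (m'+1, n'-1)}"
      and "\<forall>h. affine_on_black a b c R h \<longrightarrow> h m n = of_real (1 - t) * h i j + of_real t * h k l"
      using black_middle[where R = R, OF triangleD(1-3) R_nz[OF assms], of m n]
      by (elim exE conjE) (rule that)
    then have aff: "\<And>h. affine_on_black a b c R h \<Longrightarrow>
        h m n = of_real (1 - t) * h i j + of_real t * h k l" by blast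
    have mem: "(m, n) \<in> {(m', n'), (m'+1, n'), (m'+1, n'-1)}"
      "(i, j) \<in> {(m', n'), (m'+1, n'), (m'+1, n'-1)}" "(k, l) \<in> {(m', n'), (m'+1, n'), (m'+1, n'-1)}"
      unfolding face[symmetric] by simp_all
    \<comment> \<open>The three corners of a black face are distinct indices, so a coincidence would
      leave a set of at most two.\<close>
    have "(i, j) \<noteq> (k, l)"
    proof
      assume "(i, j) = (k, l)"
      then have "card {(m, n), (i, j), (k, l)} \<le> 2" by (simp add: card_insert_if)
      then show False unfolding face by simp
    qed
    then have ne: "\<psi> i j \<noteq> \<psi> k l" using norm_edge(2)[OF mem(2,3) assms] by simp
    have mid: "\<psi> m n \<in> open_segment (\<psi> i j) (\<psi> k l)"
      unfolding in_segment using aff[OF affine_on_black_psi] t ne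
      by (auto simp: scaleR_conv_of_real intro!: exI[of _ t])
    have "case_prod \<psi> ` {(m, n), (i, j), (k, l)} = case_prod \<psi> ` {(m', n'), (m'+1, n'), (m'+1, n'-1)}"
      unfolding face ..
    then have "black_face \<psi> m' n' = convex hull {\<psi> m n, \<psi> i j, \<psi> k l}"
      by (simp add: black_face_def)
    also have "\<dots> = closed_segment (\<psi> i j) (\<psi> k l)"
      using mid by (intro convex_hull_three_collinear) (auto simp: open_segment_def)
    finally have "splits \<psi> (\<psi> m n) (\<psi> i j) (\<psi> k l)"
      using mid unfolding splits_def segments_def by (metis (mono_tags, lifting) mem_Collect_eq)
    with t ne aff[OF affine_on_black_psi] aff[OF G(1)] norm_edge(1)[OF mem(2,1)] norm_edge(1)[OF mem(3,1)]
    show ?thesis unfolding u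
      by (intro exI[of _ "(i, j)"] exI[of _ "(k, l)"] exI[of _ t]) simp
  qed
  then obtain P Q t where *: "\<And>u. 0 < t u \<and> t u < 1 \<and> case_prod \<psi> (P u) \<noteq> case_prod \<psi> (Q u) \<and>
      case_prod \<psi> u = of_real (1 - t u) * case_prod \<psi> (P u) + of_real (t u) * case_prod \<psi> (Q u) \<and>
      case_prod G u = of_real (1 - t u) * case_prod G (P u) + of_real (t u) * case_prod G (Q u) \<and>
      cmod (case_prod \<psi> (P u) - case_prod \<psi> u) \<le> a + b + c \<and>
      cmod (case_prod \<psi> (Q u) - case_prod \<psi> u) \<le> a + b + c \<and>
      splits \<psi> (case_prod \<psi> u) (case_prod \<psi> (P u)) (case_prod \<psi> (Q u))"
    by metis
  have "balanced_graph (case_prod \<psi>) (case_prod G) P Q t C (a + b + c)"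
  proof (rule balanced_graph.intro)
    fix u :: "int \<times> int" and r :: real
    note * = *[of u, THEN conjunct1] *[of u, THEN conjunct2, THEN conjunct1]
      *[of u, THEN conjunct2, THEN conjunct2]
    show "0 < t u" "t u < 1" by (fact *)+
    show "case_prod \<psi> u = of_real (1 - t u) * case_prod \<psi> (P u) + of_real (t u) * case_prod \<psi> (Q u)"
      "case_prod G u = of_real (1 - t u) * case_prod G (P u) + of_real (t u) * case_prod G (Q u)"
      "case_prod \<psi> (P u) \<noteq> case_prod \<psi> (Q u)"
      "cmod (case_prod \<psi> (P u) - case_prod \<psi> u) \<le> a + b + c"
      "cmod (case_prod \<psi> (Q u) - case_prod \<psi> u) \<le> a + b + c"
      using *(3) by - (elim conjE, assumption)+
    show "cmod (case_prod G u - (case_prod \<psi> u)\<^sup>2) \<le> C" by (cases u) (simp add: G(2))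
    show "finite {u. cmod (case_prod \<psi> u) \<le> r}" by (rule locally_finite)
  qed
  with * show ?thesis by blast
qed

end

section \<open>Second-order expansions and barriers\<close>

text \<open>Uniform continuity on a compact neighbourhood of K instead of K itself, so that the
  second point may leave K; this is used for vertices one step away.\<close>

lemma compact_uniform_near:
  fixes g :: "'a::heine_borel \<Rightarrow> 'b::metric_space"
  assumes "compact K" "open S" "K \<subseteq> S" "continuous_on S g" "e > 0"
  obtains d where "d > 0"
    "\<And>x y. x \<in> K \<Longrightarrow> dist y x \<le> d \<Longrightarrow> y \<in> S \<and> dist (g y) (g x) < e"
proof (cases "K = {}")
  case True
  then show ?thesis using that[of 1] by simp
next
  case False
  obtain s where s: "s > 0" "{x. infdist x K \<le> s} \<subseteq> S"
    using compact_in_open_separated[OF False assms(1-3)] by blast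
  have "compact {x. infdist x K \<le> s}" using compact_infdist_le False assms(1) s(1) by blast
  then have "uniformly_continuous_on {x. infdist x K \<le> s} g"
    using assms(4) s(2) compact_uniformly_continuous continuous_on_subset by blast
  then obtain d where d: "d > 0" "\<And>x y. infdist x K \<le> s \<Longrightarrow> infdist y K \<le> s \<Longrightarrow>
      dist y x < d \<Longrightarrow> dist (g y) (g x) < e"
    unfolding uniformly_continuous_on_def using \<open>e > 0\<close> by (metis mem_Collect_eq)
  show ?thesis
  proof (rule that[of "min s (d / 2)"])
    fix x y assume x: "x \<in> K" and y: "dist y x \<le> min s (d / 2)"
    have "infdist x K \<le> s" using x s(1) by simp
    moreover have "infdist y K \<le> s" using infdist_le[OF x, of y] y by simp
    ultimately show "y \<in> S \<and> dist (g y) (g x) < e" using d y s(2) by auto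
  qed (use s(1) d(1) in auto)
qed

section \<open>Uniform second-order Taylor expansion\<close>

lemma dir_deriv_conv:
  assumes "F differentiable at w"
  shows "dir_deriv h F w = Re h * dir_deriv 1 F w + Im h * dir_deriv \<i> F w"
proof -
  interpret linear "frechet_derivative F (at w)"
    using assms by (rule linear_frechet_derivative)
  have "h = Re h *\<^sub>R 1 + Im h *\<^sub>R \<i>" by (simp add: complex_eq_iff)
  then have "dir_deriv h F w = frechet_derivative F (at w) (Re h *\<^sub>R 1 + Im h *\<^sub>R \<i>)" by simp
  then show ?thesis by (simp add: add scaleR)
qed

lemma Ck_on_2D:
  assumes "open S" "Ck_on 2 F S"
  shows "w \<in> S \<Longrightarrow> F differentiable at w"
    and "w \<in> S \<Longrightarrow> dir_deriv h F differentiable at w"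
    and "continuous_on S (dir_deriv k (dir_deriv h F))"
  using assms by (auto simp: numeral_2_eq_2 differentiable_on_eq_differentiable_at)

lemma dir_deriv2_conv:
  assumes "open S" "Ck_on 2 F S" "w \<in> S"
  shows "dir_deriv h (dir_deriv h F) w = (Re h)\<^sup>2 * dir_deriv 1 (dir_deriv 1 F) w
    + Re h * Im h * (dir_deriv \<i> (dir_deriv 1 F) w + dir_deriv 1 (dir_deriv \<i> F) w)
    + (Im h)\<^sup>2 * dir_deriv \<i> (dir_deriv \<i> F) w"
proof -
  note D = Ck_on_2D[OF assms(1,2)]
  have "((\<lambda>z. Re h * dir_deriv 1 F z + Im h * dir_deriv \<i> F z) has_derivative
     (\<lambda>k. Re h * frechet_derivative (dir_deriv 1 F) (at w) k
        + Im h * frechet_derivative (dir_deriv \<i> F) (at w) k)) (at w)"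
    using D(2)[OF assms(3)] unfolding frechet_derivative_works
    by (intro has_derivative_add has_derivative_mult_right)
  then have "(dir_deriv h F has_derivative
     (\<lambda>k. Re h * frechet_derivative (dir_deriv 1 F) (at w) k
        + Im h * frechet_derivative (dir_deriv \<i> F) (at w) k)) (at w)"
    by (rule has_derivative_transform_within_open[OF _ assms(1,3)])
      (rule dir_deriv_conv[OF D(1), symmetric])
  from fun_cong[OF frechet_derivative_at[OF this], of h]
  have "dir_deriv h (dir_deriv h F) w =
      Re h * dir_deriv h (dir_deriv 1 F) w + Im h * dir_deriv h (dir_deriv \<i> F) w" by simp
  then show ?thesis
    unfolding dir_deriv_conv[of "dir_deriv 1 F" w h, OF D(2)[OF assms(3)]]
      dir_deriv_conv[of "dir_deriv \<i> F" w h, OF D(2)[OF assms(3)]]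
    by (simp add: power2_eq_square algebra_simps)
qed

lemma dir_deriv_DERIV:
  assumes "F differentiable at (z + of_real t * h)"
  shows "DERIV (\<lambda>t. F (z + of_real t * h)) t :> dir_deriv h F (z + of_real t * h)"
proof -
  let ?D = "frechet_derivative F (at (z + of_real t * h))"
  have "((\<lambda>t. z + of_real t * h) has_derivative (\<lambda>s. of_real s * h)) (at t)"
    by (auto intro!: derivative_eq_intros)
  then have "((\<lambda>t. F (z + of_real t * h)) has_derivative (\<lambda>s. ?D (of_real s * h))) (at t)"
    using assms unfolding frechet_derivative_works by (rule has_derivative_compose)
  moreover have "(\<lambda>s. ?D (of_real s * h)) = (*) (?D h)"
  proof
    fix s
    show "?D (of_real s * h) = ?D h * s"
      using linear_scale[OF linear_frechet_derivative[OF assms], of s h]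
      by (simp add: scaleR_conv_of_real)
  qed
  ultimately show ?thesis by (simp add: has_field_derivative_def)
qed

lemma second_order_segment:
  assumes "open S" "Ck_on 2 F S" "closed_segment z (z + h) \<subseteq> S"
  obtains t where "0 \<le> t" "t \<le> 1"
    "F (z + h) = F z + dir_deriv h F z + dir_deriv h (dir_deriv h F) (z + of_real t * h) / 2"
proof -
  note D = Ck_on_2D[OF assms(1,2)]
  have seg: "z + of_real t * h \<in> S" if "0 \<le> t" "t \<le> 1" for t
  proof -
    have "z + of_real t * h \<in> closed_segment z (z + h)"
      unfolding in_segment using that by (auto simp: scaleR_conv_of_real algebra_simps intro!: exI[of _ t])
    then show ?thesis using assms(3) by blast
  qed
  define diff where "diff = (\<lambda>(m::nat) t. if m = 0 then F (z + of_real t * h)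
      else if m = 1 then dir_deriv h F (z + of_real t * h)
      else dir_deriv h (dir_deriv h F) (z + of_real t * h))"
  have "\<exists>t. 0 < t \<and> t < 1 \<and> F (z + of_real 1 * h) =
      (\<Sum>m<2. diff m 0 / fact m * 1 ^ m) + diff 2 t / fact 2 * 1 ^ 2"
  proof (rule Maclaurin)
    show "\<forall>m t. m < 2 \<and> 0 \<le> t \<and> t \<le> 1 \<longrightarrow> DERIV (diff m) t :> diff (Suc m) t"
    proof (intro allI impI)
      fix m :: nat and t :: real assume *: "m < 2 \<and> 0 \<le> t \<and> t \<le> 1"
      then have "m = 0 \<or> m = 1" by auto
      then show "DERIV (diff m) t :> diff (Suc m) t"
        using * dir_deriv_DERIV[OF D(1)[OF seg], of t] dir_deriv_DERIV[OF D(2)[OF seg], of t h]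
        by (auto simp: diff_def[abs_def])
    qed
  qed (simp_all add: diff_def)
  then obtain t where "0 < t" "t < 1"
    "F (z + h) = F z + dir_deriv h F z + dir_deriv h (dir_deriv h F) (z + of_real t * h) / 2"
    by (auto simp: diff_def lessThan_nat_numeral numeral_2_eq_2)
  then show ?thesis using that[of t] by simp
qed

text \<open>The Lagrange remainder differs from the second-order term at v only by the oscillation
  of the second derivatives, which is uniformly small close to K.\<close>

lemma second_order_uniform:
  assumes "open S" "Ck_on 2 F S" "compact K" "K \<subseteq> S" "e > 0"
  obtains s where "s > 0" "\<And>v h. v \<in> K \<Longrightarrow> cmod h \<le> s \<Longrightarrow> v + h \<in> S \<and>
    \<bar>F (v + h) - F v - dir_deriv h F v - dir_deriv h (dir_deriv h F) v / 2\<bar> \<le> e * (cmod h)\<^sup>2"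
proof -
  note D = Ck_on_2D[OF assms(1,2)]
  define H where "H = (\<lambda>w. (dir_deriv 1 (dir_deriv 1 F) w,
     dir_deriv \<i> (dir_deriv 1 F) w + dir_deriv 1 (dir_deriv \<i> F) w, dir_deriv \<i> (dir_deriv \<i> F) w))"
  have "continuous_on S H" unfolding H_def by (intro continuous_intros D(3))
  then obtain s where s: "s > 0"
    "\<And>x y. x \<in> K \<Longrightarrow> dist y x \<le> s \<Longrightarrow> y \<in> S \<and> dist (H y) (H x) < e / 2"
    using compact_uniform_near[OF assms(3,1,4), of H "e / 2"] \<open>e > 0\<close> by auto
  show ?thesis
  proof (rule that[OF s(1)], intro conjI)
    fix v h assume v: "v \<in> K" and h: "cmod h \<le> s"
    show "v + h \<in> S" using s(2)[OF v, of "v + h"] h by (simp add: dist_norm)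
    have "closed_segment v (v + h) \<subseteq> S"
    proof
      fix y assume "y \<in> closed_segment v (v + h)"
      then have "dist y v \<le> cmod h" using segment_bound(1)[of y v "v + h"] by (simp add: dist_norm)
      then show "y \<in> S" using s(2)[OF v, of y] h by simp
    qed
    then obtain t where t: "0 \<le> t" "t \<le> 1"
      "F (v + h) = F v + dir_deriv h F v + dir_deriv h (dir_deriv h F) (v + of_real t * h) / 2"
      using second_order_segment[OF assms(1,2)] by blast
    define w where "w = v + of_real t * h"
    have "dist w v \<le> s"
      using mult_left_le_one_le[of "cmod h" t] t h by (simp add: w_def dist_norm norm_mult)
    then have w: "w \<in> S" "dist (H w) (H v) < e / 2" using s(2)[OF v] by auto
    have comp: "\<bar>fst x\<bar> \<le> norm x \<and> \<bar>fst (snd x)\<bar> \<le> norm x \<and> \<bar>snd (snd x)\<bar> \<le> norm x"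
      for x :: "real \<times> real \<times> real"
      using norm_fst_le[of "fst x" "snd x"] norm_snd_le[of "snd x" "fst x"]
        norm_fst_le[of "fst (snd x)" "snd (snd x)"] norm_snd_le[of "snd (snd x)" "fst (snd x)"] by auto
    define x y where "x = Re h" and "y = Im h"
    define A B C where "A = fst (H w - H v)" and "B = fst (snd (H w - H v))" and "C = snd (snd (H w - H v))"
    have ABC: "\<bar>A\<bar> \<le> e / 2" "\<bar>B\<bar> \<le> e / 2" "\<bar>C\<bar> \<le> e / 2"
      using comp[of "H w - H v"] w(2) by (auto simp: dist_norm A_def B_def C_def)
    have "dir_deriv h (dir_deriv h F) w - dir_deriv h (dir_deriv h F) v
        = x\<^sup>2 * A + x * y * B + y\<^sup>2 * C"
      using v assms(4) unfolding dir_deriv2_conv[where h = h, OF assms(1,2) w(1)]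
      by (subst dir_deriv2_conv[where h = h, OF assms(1,2)])
        (auto simp: A_def B_def C_def H_def x_def y_def algebra_simps)
    also have "\<bar>\<dots>\<bar> \<le> x\<^sup>2 * (e / 2) + \<bar>x * y\<bar> * (e / 2) + y\<^sup>2 * (e / 2)"
    proof -
      have "\<bar>x\<^sup>2 * A\<bar> \<le> x\<^sup>2 * (e / 2)" "\<bar>x * y * B\<bar> \<le> \<bar>x * y\<bar> * (e / 2)" "\<bar>y\<^sup>2 * C\<bar> \<le> y\<^sup>2 * (e / 2)"
        using mult_left_mono[OF ABC(1), of "x\<^sup>2"] mult_left_mono[OF ABC(2), of "\<bar>x * y\<bar>"]
          mult_left_mono[OF ABC(3), of "y\<^sup>2"] by (simp_all add: abs_mult)
      then show ?thesis by linarith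
    qed
    also have "\<dots> \<le> 2 * e * (x\<^sup>2 + y\<^sup>2)"
    proof -
      have "\<bar>x * y\<bar> \<le> x\<^sup>2 + y\<^sup>2"
        using sum_squares_bound[of "\<bar>x\<bar>" "\<bar>y\<bar>"] abs_ge_zero[of "x * y"]
        unfolding abs_mult[symmetric] mult.assoc power2_abs by linarith
      then have "\<bar>x * y\<bar> * (e / 2) \<le> (x\<^sup>2 + y\<^sup>2) * (e / 2)" using \<open>e > 0\<close> by (intro mult_right_mono) auto
      moreover have "0 \<le> (x\<^sup>2 + y\<^sup>2) * e" using \<open>e > 0\<close> by simp
      ultimately show ?thesis by (simp add: algebra_simps)
    qed
    also have "x\<^sup>2 + y\<^sup>2 = (cmod h)\<^sup>2" by (simp add: x_def y_def cmod_power2)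
    finally show "\<bar>F (v + h) - F v - dir_deriv h F v - dir_deriv h (dir_deriv h F) v / 2\<bar> \<le> e * (cmod h)\<^sup>2"
      unfolding t(3) w_def[symmetric] by simp
  qed
qed

text \<open>A vanishing Laplacian makes the quadratic form of the Hessian the real part of a complex
  square term, which is the shape \<open>comparison\<close> asks for. Compactness of K bounds the
  coefficients A.\<close>

lemma harmonic_on_quadratic:
  assumes "open U" "harmonic_on f U" "compact K" "K \<subseteq> U" "e > 0"
  obtains s M where "s > 0" "\<And>v. v \<in> K \<Longrightarrow> \<exists>A B. cmod A \<le> M \<and> (\<forall>h. cmod h \<le> s \<longrightarrow>
     \<bar>f (v + h) - (f v + Re (B * h) + Re (A * h\<^sup>2))\<bar> \<le> e * (cmod h)\<^sup>2)"
proof -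
  have C2: "Ck_on 2 f U" and lap: "\<And>z. z \<in> U \<Longrightarrow> dir_deriv \<i> (dir_deriv \<i> f) z = - dir_deriv 1 (dir_deriv 1 f) z"
    using assms(2) by (auto simp: harmonic_on_def)
  note D = Ck_on_2D[OF assms(1) C2]
  define A where "A = (\<lambda>w. Complex (dir_deriv 1 (dir_deriv 1 f) w / 2)
     (- (dir_deriv \<i> (dir_deriv 1 f) w + dir_deriv 1 (dir_deriv \<i> f) w) / 4))"
  define B where "B = (\<lambda>w. Complex (dir_deriv 1 f w) (- dir_deriv \<i> f w))"
  have "continuous_on U A" unfolding A_def by (intro continuous_intros D(3)) simp_all
  then have "compact (A ` K)"
    using assms(3,4) compact_continuous_image continuous_on_subset by blast
  then obtain M where M: "\<And>w. w \<in> K \<Longrightarrow> cmod (A w) \<le> M"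
    by (metis compact_imp_bounded bounded_iff imageI)
  obtain s where s: "s > 0" "\<And>v h. v \<in> K \<Longrightarrow> cmod h \<le> s \<Longrightarrow> v + h \<in> U \<and>
    \<bar>f (v + h) - f v - dir_deriv h f v - dir_deriv h (dir_deriv h f) v / 2\<bar> \<le> e * (cmod h)\<^sup>2"
    using second_order_uniform[OF assms(1) C2 assms(3,4,5)] by blast
  have "\<bar>f (v + h) - (f v + Re (B v * h) + Re (A v * h\<^sup>2))\<bar> \<le> e * (cmod h)\<^sup>2"
    if "v \<in> K" "cmod h \<le> s" for v h
  proof -
    have v: "v \<in> U" using that assms(4) by blast
    have 1: "dir_deriv h f v = Re (B v * h)"
      unfolding B_def by (subst dir_deriv_conv[where h = h, OF D(1)[OF v]]) simp
    have 2: "dir_deriv h (dir_deriv h f) v / 2 = Re (A v * h\<^sup>2)"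
      unfolding dir_deriv2_conv[where h = h, OF assms(1) C2 v] lap[OF v]
      by (simp add: A_def power2_eq_square field_simps)
    show ?thesis using s(2)[OF that] unfolding 1 2 by (simp only: diff_diff_eq add.assoc)
  qed
  then show ?thesis using that[OF s(1)] M by blast
qed

text \<open>Taylor expansion of \<rho> at p puts nearby points p + h of U in the region Re (B h)
  \<le> C |h|^2. The ball is centred on the outward normal, whose direction is cnj B, and is smaller
  than the curvature demands; this surplus produces the term |z - p|^2 / 2.\<close>

lemma exterior_ball:
  assumes "smooth_domain U" "p \<in> frontier U"
  obtains c r where "r > 0" "cmod (p - c) = r"
    "\<And>z. z \<in> closure U \<Longrightarrow> r\<^sup>2 + (cmod (z - p))\<^sup>2 / 2 \<le> (cmod (z - c))\<^sup>2"
proof -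
  obtain V \<rho> where *: "open V \<and> p \<in> V \<and> (\<forall>k. Ck_on k \<rho> V) \<and>
      (\<forall>z\<in>V. \<exists>v. dir_deriv v \<rho> z \<noteq> 0) \<and> U \<inter> V = {z \<in> V. \<rho> z < 0}"
    using bspec[OF conjunct2[OF conjunct2[OF assms(1)[unfolded smooth_domain_def]]] assms(2)]
    by (elim exE) (rule that)
  then have V: "open V" "p \<in> V" and smooth: "\<forall>k. Ck_on k \<rho> V"
    and nz: "\<forall>z\<in>V. \<exists>v. dir_deriv v \<rho> z \<noteq> 0" and UV: "U \<inter> V = {z \<in> V. \<rho> z < 0}"
    by - (elim conjE, assumption)+
  note C2 = spec[OF smooth, of 2]
  have "open U" using assms(1) by (simp add: smooth_domain_def)
  have "p \<notin> U" using assms(2) \<open>open U\<close> by (simp add: frontier_def interior_open)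
  then have "\<rho> p \<ge> 0" using V(2) UV by force
  define B where "B = Complex (dir_deriv 1 \<rho> p) (- dir_deriv \<i> \<rho> p)"
  have B: "dir_deriv h \<rho> p = Re (B * h)" for h
    unfolding B_def by (subst dir_deriv_conv[where h = h, OF Ck_on_2D(1)[OF V(1) C2 V(2)]]) simp
  then have "B \<noteq> 0" using bspec[OF nz V(2)] by auto
  define H where "H = \<bar>dir_deriv 1 (dir_deriv 1 \<rho>) p\<bar>
     + \<bar>dir_deriv \<i> (dir_deriv 1 \<rho>) p + dir_deriv 1 (dir_deriv \<i> \<rho>) p\<bar> + \<bar>dir_deriv \<i> (dir_deriv \<i> \<rho>) p\<bar>"
  have H: "\<bar>dir_deriv h (dir_deriv h \<rho>) p\<bar> \<le> H * (cmod h)\<^sup>2" for h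
  proof -
    have sq: "\<bar>(Re h)\<^sup>2\<bar> \<le> (cmod h)\<^sup>2" "\<bar>(Im h)\<^sup>2\<bar> \<le> (cmod h)\<^sup>2" "\<bar>Re h * Im h\<bar> \<le> (cmod h)\<^sup>2"
      using sum_squares_bound[of "\<bar>Re h\<bar>" "\<bar>Im h\<bar>"] abs_ge_zero[of "Re h * Im h"]
      unfolding abs_mult[symmetric] mult.assoc power2_abs cmod_power2 abs_power2 by simp_all
    have "\<bar>x * k\<bar> \<le> \<bar>k\<bar> * (cmod h)\<^sup>2" if "\<bar>x\<bar> \<le> (cmod h)\<^sup>2" for x k :: real
      using mult_left_mono[OF that, of "\<bar>k\<bar>"] by (simp add: abs_mult mult.commute)
    from this[OF sq(1), of "dir_deriv 1 (dir_deriv 1 \<rho>) p"]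
      this[OF sq(3), of "dir_deriv \<i> (dir_deriv 1 \<rho>) p + dir_deriv 1 (dir_deriv \<i> \<rho>) p"]
      this[OF sq(2), of "dir_deriv \<i> (dir_deriv \<i> \<rho>) p"]
    show ?thesis unfolding dir_deriv2_conv[where h = h, OF V(1) C2 V(2)] H_def distrib_right
      by linarith
  qed
  obtain s where s0: "s > 0" "\<And>v h. v \<in> {p} \<Longrightarrow> cmod h \<le> s \<Longrightarrow> v + h \<in> V \<and>
    \<bar>\<rho> (v + h) - \<rho> v - dir_deriv h \<rho> v - dir_deriv h (dir_deriv h \<rho>) v / 2\<bar> \<le> 1 * (cmod h)\<^sup>2"
    using second_order_uniform[OF V(1) C2, of "{p}" 1] V(2)
    by (metis compact_sing empty_subsetI insert_subset zero_less_one)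
  note s = s0(1) s0(2)[OF singletonI]
  define C where "C = H + 1"
  have "C > 0" by (simp add: C_def H_def add_nonneg_pos)
  have local: "Re (B * h) \<le> C * (cmod h)\<^sup>2" if "cmod h \<le> s" "p + h \<in> U" for h
  proof -
    have "\<rho> (p + h) < 0" using that s(2) UV by blast
    moreover have "0 \<le> H * (cmod h)\<^sup>2" by (simp add: H_def)
    ultimately show ?thesis
      using s(2)[OF that(1)] H[of h] \<open>\<rho> p \<ge> 0\<close> unfolding B C_def by (simp add: algebra_simps abs_le_iff)
  qed
  \<comment> \<open>The first bound makes the ball small against the curvature constant C; the
    second handles points of U farther than s from p, where the expansion of \<rho> says
    nothing.\<close>
  define r where "r = min (cmod B / (4 * C)) (s / 4)"
  define c where "c = p + of_real (r / cmod B) * cnj B"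
  have r: "r > 0" "4 * (r / cmod B) * C \<le> 1" "4 * r \<le> s"
  proof -
    show "r > 0" "4 * r \<le> s" using \<open>B \<noteq> 0\<close> \<open>C > 0\<close> s(1) by (auto simp: r_def)
    have "r \<le> cmod B / (4 * C)" by (simp add: r_def)
    then show "4 * (r / cmod B) * C \<le> 1" using \<open>B \<noteq> 0\<close> \<open>C > 0\<close> by (simp add: field_simps)
  qed
  have pc: "cmod (p - c) = r" using r(1) \<open>B \<noteq> 0\<close> by (simp add: c_def norm_mult norm_divide)
  have U: "r\<^sup>2 + (cmod (z - p))\<^sup>2 / 2 \<le> (cmod (z - c))\<^sup>2" if z: "z \<in> U" for z
  proof -
    define h where "h = z - p"
    have eq: "(cmod (z - c))\<^sup>2 = (cmod h)\<^sup>2 - 2 * (r / cmod B) * Re (B * h) + r\<^sup>2"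
    proof -
      have "(cmod (z - c))\<^sup>2 = (cmod (h - of_real (r / cmod B) * cnj B))\<^sup>2"
        by (simp add: h_def c_def algebra_simps)
      also have "\<dots> = (cmod h)\<^sup>2 - 2 * (r / cmod B) * Re (B * h) + (r / cmod B)\<^sup>2 * (cmod B)\<^sup>2"
        unfolding cmod_power2 by (simp add: power2_eq_square algebra_simps)
      finally show ?thesis using \<open>B \<noteq> 0\<close> by (simp add: power_divide)
    qed
    have "2 * (r / cmod B) * Re (B * h) \<le> (cmod h)\<^sup>2 / 2"
    proof (cases "cmod h \<le> s")
      case True
      then have "2 * (r / cmod B) * Re (B * h) \<le> 2 * (r / cmod B) * (C * (cmod h)\<^sup>2)"
        using local[of h] z r(1) by (intro mult_left_mono) (auto simp: h_def)
      also have "\<dots> = (4 * (r / cmod B) * C) * (cmod h)\<^sup>2 / 2" by simp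
      also have "\<dots> \<le> 1 * (cmod h)\<^sup>2 / 2" using r(2) by (intro divide_right_mono mult_right_mono) auto
      finally show ?thesis by simp
    next
      case False
      have "2 * (r / cmod B) * Re (B * h) \<le> 2 * (r / cmod B) * (cmod B * cmod h)"
        using complex_Re_le_cmod[of "B * h"] r(1) by (intro mult_left_mono) (auto simp: norm_mult)
      also have "\<dots> = (4 * r) * cmod h / 2" using \<open>B \<noteq> 0\<close> by simp
      also have "\<dots> \<le> cmod h * cmod h / 2"
        using r(3) False by (intro divide_right_mono mult_right_mono) auto
      finally show ?thesis by (simp add: power2_eq_square)
    qed
    then show ?thesis unfolding eq by (simp add: h_def)
  qed
  have "closed {z. r\<^sup>2 + (cmod (z - p))\<^sup>2 / 2 \<le> (cmod (z - c))\<^sup>2}"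
    by (intro closed_Collect_le continuous_intros) auto
  then have "closure U \<subseteq> {z. r\<^sup>2 + (cmod (z - p))\<^sup>2 / 2 \<le> (cmod (z - c))\<^sup>2}"
    using U by (intro closure_minimal) auto
  then show ?thesis using that[OF r(1) pc] by blast
qed

text \<open>From 1 / (1 + t) = 1 - t + t^2 - ..., the left side is -1 + 2 Re t - 2 Re (t^2) - |t|^2
  up to a cubic error, and half of |t|^2 is given up to absorb that error. The logarithm would be
  harmonic without this strict loss.\<close>

lemma inverse_square_expansion_unit:
  assumes "cmod t \<le> 1 / 20"
  shows "- 1 / (cmod (1 + t))\<^sup>2 \<le> - 1 + 2 * Re t - 2 * Re (t\<^sup>2) - (cmod t)\<^sup>2 / 2"
proof -
  define x y where "x = Re t" and "y = Im t"
  have xb: "\<bar>x\<bar> \<le> 1 / 20" using abs_Re_le_cmod[of t] assms by (simp add: x_def)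
  define N where "N = 1 + 2 * x + (x\<^sup>2 + y\<^sup>2)"
  have N: "(cmod (1 + t))\<^sup>2 = N" unfolding cmod_power2 by (simp add: N_def x_def y_def power2_eq_square algebra_simps)
  have "N > 0" using xb zero_le_power2[of x] zero_le_power2[of y] unfolding N_def by linarith
  define q where "q = - 1 + 2 * x - 5/2 * x\<^sup>2 + 3/2 * y\<^sup>2"
  \<comment> \<open>After multiplication by N the terms up to order one cancel, and both remaining
    brackets stay close to 1/2 or at least positive for |x| \<le> 1/20.\<close>
  have "N * q + 1 = x\<^sup>2 * (1/2 - 3 * x - 5/2 * x\<^sup>2) + y\<^sup>2 * (1/2 + 5 * x - x\<^sup>2 + 3/2 * y\<^sup>2)"
    unfolding N_def q_def by (simp add: power2_eq_square field_simps)
  moreover have x2: "x\<^sup>2 \<le> 1 / 400"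
    using power_mono[OF xb, of 2] by (simp add: power_divide)
  have "0 \<le> x\<^sup>2 * (1/2 - 3 * x - 5/2 * x\<^sup>2)" "0 \<le> y\<^sup>2 * (1/2 + 5 * x - x\<^sup>2 + 3/2 * y\<^sup>2)"
    using xb x2 zero_le_power2[of y] by (auto intro!: mult_nonneg_nonneg simp: abs_le_iff)
  ultimately have "- 1 \<le> N * q" by linarith
  then have "- 1 / N \<le> q" using \<open>N > 0\<close> by (simp add: field_simps)
  moreover have "q = - 1 + 2 * Re t - 2 * Re (t\<^sup>2) - (cmod t)\<^sup>2 / 2"
    unfolding cmod_power2 by (simp add: q_def x_def y_def power2_eq_square field_simps)
  ultimately show ?thesis unfolding N by simp
qed

lemma inverse_square_expansion:
  assumes "a \<noteq> 0" "cmod h \<le> cmod a / 20"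
  shows "- 1 / (cmod (a + h))\<^sup>2 \<le> - 1 / (cmod a)\<^sup>2 + Re (2 / (a * (cmod a)\<^sup>2) * h)
    + Re (- 2 / (a\<^sup>2 * (cmod a)\<^sup>2) * h\<^sup>2) - (cmod h)\<^sup>2 / (2 * (cmod a) ^ 4)"
proof -
  define t where "t = h / a"
  have "cmod t \<le> 1 / 20" using assms by (simp add: t_def norm_divide field_simps)
  then have "(- 1 / (cmod (1 + t))\<^sup>2) / (cmod a)\<^sup>2 \<le>
      (- 1 + 2 * Re t - 2 * Re (t\<^sup>2) - (cmod t)\<^sup>2 / 2) / (cmod a)\<^sup>2"
    by (intro divide_right_mono inverse_square_expansion_unit) auto
  moreover have "a + h = a * (1 + t)" using assms by (simp add: t_def field_simps)
  then have "(cmod (a + h))\<^sup>2 = (cmod a)\<^sup>2 * (cmod (1 + t))\<^sup>2" by (simp add: norm_mult power_mult_distrib)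
  moreover have "Re (2 / (a * (cmod a)\<^sup>2) * h) = 2 * Re t / (cmod a)\<^sup>2"
  proof -
    have "2 / (a * (cmod a)\<^sup>2) * h = of_real (2 / (cmod a)\<^sup>2) * t" by (simp add: t_def)
    then show ?thesis by (simp only: times_complex.sel Re_complex_of_real Im_complex_of_real) simp
  qed
  moreover have "Re (- 2 / (a\<^sup>2 * (cmod a)\<^sup>2) * h\<^sup>2) = - 2 * Re (t\<^sup>2) / (cmod a)\<^sup>2"
  proof -
    have "- 2 / (a\<^sup>2 * (cmod a)\<^sup>2) * h\<^sup>2 = of_real (- 2 / (cmod a)\<^sup>2) * t\<^sup>2" by (simp add: t_def power_divide)
    then show ?thesis by (simp only: times_complex.sel Re_complex_of_real Im_complex_of_real) simp
  qed
  moreover have "(cmod h)\<^sup>2 / (2 * (cmod a) ^ 4) = (cmod t)\<^sup>2 / 2 / (cmod a)\<^sup>2"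
    by (simp add: t_def norm_divide power_divide power4_eq_xxxx power2_eq_square)
  ultimately show ?thesis by (simp add: diff_divide_distrib add_divide_distrib mult.commute)
qed

section \<open>The discrete Dirichlet problem\<close>

context balanced_graph
begin

lemma step_rescaled:
  assumes "x \<in> {P u, Q u}" "n > 0"
  shows "dist (Z x / of_nat n) (Z u / of_nat n) \<le> D / real n"
proof -
  have "cmod (Z x - Z u) \<le> D" using assms(1) step[of u] by blast
  then have "cmod ((Z x - Z u) / of_nat n) \<le> D / real n"
    unfolding norm_divide norm_of_nat by (rule divide_right_mono) simp
  then show ?thesis by (simp add: dist_norm diff_divide_distrib)
qed

lemma step_eventually_small:
  assumes "d > 0"
  shows "\<forall>\<^sub>F n in sequentially. \<forall>u. \<forall>x\<in>{P u, Q u}. dist (Z x / of_nat n) (Z u / of_nat n) < d"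
  using order_tendstoD(2)[OF lim_const_over_n[of D] assms] eventually_gt_at_top[of 0]
proof eventually_elim
  case (elim n)
  then show ?case using step_rescaled[OF _ elim(2)] by (blast intro: le_less_trans)
qed

end

locale discrete_dirichlet = balanced_graph +
  fixes U :: "complex set" and f :: "complex \<Rightarrow> real" and g :: "nat \<Rightarrow> 'a \<Rightarrow> real"
  assumes bounded_U: "bounded U" and cont: "continuous_on (closure U) f"
    and harm: "n \<ge> 1 \<Longrightarrow> Z u / of_nat n \<in> U \<Longrightarrow> harmonic_at (g n) u"
    and bdry: "n \<ge> 1 \<Longrightarrow> Z u / of_nat n \<in> U \<Longrightarrow> x \<in> {P u, Q u} \<Longrightarrow> Z x / of_nat n \<notin> U \<Longrightarrow>
      g n x = f (closest_point (closure U) (Z x / of_nat n))"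
begin

lemma compact_closure_U: "compact (closure U)"
  using bounded_U by (simp add: compact_closure)

text \<open>The barrier at \<open>p\<close> is the function \<open>1 / r\<^sup>2 - 1 / \<bar>z - c\<bar>\<^sup>2\<close>, which is strictly
  superharmonic away from the centre \<open>c\<close> of the exterior ball and vanishes on \<open>closure U\<close>
  only at \<open>p\<close>.\<close>

lemma near_boundary_point:
  assumes p: "p \<in> closure U" and r: "r > 0" "cmod (p - c) = r"
    and ball: "\<And>z. z \<in> closure U \<Longrightarrow> r\<^sup>2 + (cmod (z - p))\<^sup>2 / 2 \<le> (cmod (z - c))\<^sup>2"
    and e: "e > 0"
  shows "\<exists>d>0. \<forall>\<^sub>F n in sequentially. \<forall>u. Z u / of_nat n \<in> U \<longrightarrow>
    dist (Z u / of_nat n) p < d \<longrightarrow> g n u \<le> f (Z u / of_nat n) + 5 * e"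
proof -
  define w where "w = (\<lambda>z. 1 / r\<^sup>2 - 1 / (cmod (z - c))\<^sup>2)"
  have far: "r \<le> cmod (z - c)" if "z \<in> closure U" for z
  proof -
    have "r\<^sup>2 \<le> (cmod (z - c))\<^sup>2" using ball[OF that] zero_le_power2[of "cmod (z - p)"] by linarith
    then show ?thesis by (rule power2_le_imp_le) simp
  qed
  have w_nonneg: "0 \<le> w z" if "z \<in> closure U" for z
    using far[OF that] r(1) by (simp add: w_def frac_le power_mono)
  have "compact (f ` closure U)" using compact_continuous_image[OF cont compact_closure_U] .
  then obtain F where F: "\<And>z. z \<in> closure U \<Longrightarrow> \<bar>f z\<bar> \<le> F"
    by (metis compact_imp_bounded bounded_iff imageI real_norm_def)
  obtain \<delta> where \<delta>: "\<delta> > 0" "\<And>z. z \<in> closure U \<Longrightarrow> dist z p < \<delta> \<Longrightarrow> \<bar>f z - f p\<bar> < e"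
    using cont p e unfolding continuous_on_iff dist_real_def by blast
  define m where "m = 1 / r\<^sup>2 - 1 / (r\<^sup>2 + \<delta>\<^sup>2 / 2)"
  have m: "m > 0" using r(1) \<delta>(1) by (simp add: m_def frac_less2 add_pos_pos)
  have w_far: "m \<le> w z" if "z \<in> closure U" "\<not> dist z p < \<delta>" for z
  proof -
    have "\<delta>\<^sup>2 \<le> (cmod (z - p))\<^sup>2" using that(2) \<delta>(1) by (intro power_mono) (auto simp: dist_norm)
    then have "r\<^sup>2 + \<delta>\<^sup>2 / 2 \<le> (cmod (z - c))\<^sup>2" using ball[OF that(1)] by linarith
    moreover have "0 < r\<^sup>2 + \<delta>\<^sup>2 / 2" using r(1) by (simp add: add_pos_nonneg)
    ultimately show ?thesis unfolding m_def w_def by (simp add: frac_le)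
  qed
  \<comment> \<open>Away from p the barrier is at least m, so this multiple of it exceeds the total
    oscillation 2 F of f; the summand 1 keeps k positive even if F = 0.\<close>
  define k where "k = 2 * \<bar>F\<bar> / m + 1"
  have k: "k > 0" "2 * \<bar>F\<bar> \<le> k * m" using m by (simp_all add: k_def add_nonneg_pos field_simps)
  have f_le: "f z \<le> f p + e + k * w z" if z: "z \<in> closure U" for z
  proof (cases "dist z p < \<delta>")
    case True
    have "0 \<le> k * w z" using w_nonneg[OF z] k(1) by simp
    then show ?thesis using \<delta>(2)[OF z True] by linarith
  next
    case False
    have "k * m \<le> k * w z" using w_far[OF z False] k(1) by simp
    then show ?thesis using F[OF z] F[OF p] k(2) e by linarith
  qed
  \<comment> \<open>One e covers the oscillation of f near p, the other the passage from a boundary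
    vertex to its nearest point. Later losses are e each from \<open>comparison\<close>, from k w
    near p and from replacing f p by f, in all 5 e.\<close>
  define W where "W = (\<lambda>z. f p + 2 * e + k * w z)"
  obtain R where R: "\<And>z. z \<in> closure U \<Longrightarrow> cmod (z - c) \<le> R"
  proof -
    have "compact ((\<lambda>z. z - c) ` closure U)"
      by (intro compact_continuous_image compact_closure_U continuous_intros)
    then show thesis using that by (metis compact_imp_bounded bounded_iff imageI)
  qed
  \<comment> \<open>Every v in U satisfies r \<le> |v - c| \<le> R: the lower bound makes the
    expansion valid within r / 20 and bounds A, the upper bound gives the loss k / (2 R^4).\<close>
  have R0: "R > 0" using R[OF p] r by simp
  have quad: "\<exists>A B. cmod A \<le> k * (2 / r ^ 4) \<and> (\<forall>z. cmod (z - v) \<le> r / 20 \<longrightarrow>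
       W z \<le> W v + Re (B * (z - v)) + Re (A * (z - v)\<^sup>2) - k / (2 * R ^ 4) * (cmod (z - v))\<^sup>2)"
    if "v \<in> U" for v
  proof -
    have v: "v \<in> closure U" using that closure_subset by blast
    define a where "a = v - c"
    have a: "r \<le> cmod a" "cmod a \<le> R" using far[OF v] R[OF v] by (simp_all add: a_def)
    then have "a \<noteq> 0" using r(1) by auto
    define A where "A = - 2 / (a\<^sup>2 * (cmod a)\<^sup>2)"
    define B where "B = 2 / (a * (cmod a)\<^sup>2)"
    have "cmod A = 2 / (cmod a) ^ 4"
      by (simp add: A_def norm_divide norm_mult norm_power power4_eq_xxxx power2_eq_square)
    also have "\<dots> \<le> 2 / r ^ 4" using a(1) r(1) by (intro frac_le power_mono) auto
    finally have "k * cmod A \<le> k * (2 / r ^ 4)" using k(1) by (intro mult_left_mono) auto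
    then have A: "cmod (k * A) \<le> k * (2 / r ^ 4)" using k(1) by (simp add: norm_mult)
    have "W z \<le> W v + Re (k * B * (z - v)) + Re (k * A * (z - v)\<^sup>2) - k / (2 * R ^ 4) * (cmod (z - v))\<^sup>2"
      if "cmod (z - v) \<le> r / 20" for z
    proof -
      define h where "h = z - v"
      have "cmod h \<le> cmod a / 20" using that a(1) by (simp add: h_def)
      from inverse_square_expansion[OF \<open>a \<noteq> 0\<close> this]
      have "w z \<le> w v + Re (B * h) + Re (A * h\<^sup>2) - (cmod h)\<^sup>2 / (2 * (cmod a) ^ 4)"
        by (simp add: w_def a_def h_def A_def B_def)
      also have "\<dots> \<le> w v + Re (B * h) + Re (A * h\<^sup>2) - (cmod h)\<^sup>2 / (2 * R ^ 4)"
        using a(2) \<open>a \<noteq> 0\<close> by (intro diff_left_mono frac_le mult_left_mono power_mono) auto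
      finally have "k * w z \<le> k * (w v + Re (B * h) + Re (A * h\<^sup>2) - (cmod h)\<^sup>2 / (2 * R ^ 4))"
        using k(1) by (intro mult_left_mono) auto
      also have "\<dots> = k * w v + Re (k * B * h) + Re (k * A * h\<^sup>2) - k / (2 * R ^ 4) * (cmod h)\<^sup>2"
        by (simp add: mult.assoc distrib_left right_diff_distrib)
      finally show ?thesis by (simp add: W_def h_def)
    qed
    then show ?thesis using A by blast
  qed
  have "open (- {c})" by (rule open_Compl) (rule closed_singleton)
  moreover have "continuous_on (- {c}) w" unfolding w_def by (intro continuous_intros) auto
  moreover have "closure U \<subseteq> - {c}" using far r(1) by force
  moreover have "e / k > 0" using e k(1) by simp
  ultimately obtain d1 where d1: "d1 > 0" "\<And>y z. y \<in> closure U \<Longrightarrow> dist z y \<le> d1 \<Longrightarrow>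
      z \<in> - {c} \<and> dist (w z) (w y) < e / k"
    using compact_uniform_near[OF compact_closure_U] by blast
  have "w p = 0" using r by (simp add: w_def)
  have close: "k * w z < e" if "dist z p \<le> d1" for z
  proof -
    have "w z < e / k" using d1(2)[OF p that] \<open>w p = 0\<close> unfolding dist_real_def by linarith
    then show ?thesis using k(1) by (simp add: field_simps)
  qed
  have comp: "\<forall>\<^sub>F n in sequentially. \<forall>S g'. (\<forall>u\<in>S. Z u / of_nat n \<in> U \<and> harmonic_at g' u) \<longrightarrow>
     (\<forall>u\<in>S. \<forall>x\<in>{P u, Q u}. x \<notin> S \<longrightarrow> g' x \<le> W (Z x / of_nat n)) \<longrightarrow>
     (\<forall>u\<in>S. g' u \<le> W (Z u / of_nat n) + e)"
    by (rule comparison[OF bounded_U _ _ e quad]) (use k(1) R0 r(1) in auto)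
  have "\<forall>\<^sub>F n in sequentially. \<forall>u. Z u / of_nat n \<in> U \<longrightarrow>
    dist (Z u / of_nat n) p < min \<delta> d1 \<longrightarrow> g n u \<le> f (Z u / of_nat n) + 5 * e"
    using comp step_eventually_small[OF d1(1)] eventually_ge_at_top[of 1]
  proof eventually_elim
    case (elim n)
    define S where "S = {u. Z u / of_nat n \<in> U}"
    have bd: "g n x \<le> W (Z x / of_nat n)" if u: "u \<in> S" and x: "x \<in> {P u, Q u}" "x \<notin> S" for u x
    proof -
      define z where "z = Z x / of_nat n"
      define y where "y = closest_point (closure U) z"
      have uU: "Z u / of_nat n \<in> closure U" using u closure_subset unfolding S_def by blast
      then have y: "y \<in> closure U" unfolding y_def by (intro closest_point_in_set) auto
      \<comment> \<open>The point of u itself competes for the minimum, so the nearest point is at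
        most one step away.\<close>
      have "dist z y \<le> dist z (Z u / of_nat n)"
        unfolding y_def using uU by (intro closest_point_le) auto
      also have "\<dots> < d1" using elim(2) x(1) unfolding z_def by blast
      finally have "w y - w z < e / k" using d1(2)[OF y, of z] unfolding dist_real_def by linarith
      then have "k * (w y - w z) < e" using k(1) by (simp add: field_simps)
      moreover have "g n x = f y"
        using bdry[OF elim(3) _ x(1)] u x(2) by (simp add: S_def y_def z_def)
      ultimately show ?thesis using f_le[OF y] by (simp add: W_def z_def algebra_simps)
    qed
    have hs: "\<forall>u\<in>S. Z u / of_nat n \<in> U \<and> harmonic_at (g n) u" using harm[OF elim(3)] by (simp add: S_def)
    have bd': "\<forall>u\<in>S. \<forall>x\<in>{P u, Q u}. x \<notin> S \<longrightarrow> g n x \<le> W (Z x / of_nat n)"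
      by (intro ballI impI) (rule bd)
    have "\<forall>u\<in>S. g n u \<le> W (Z u / of_nat n) + e"
      by (rule elim(1)[THEN spec, THEN spec, THEN mp, OF hs, THEN mp, OF bd'])
    then have *: "g n u \<le> W (Z u / of_nat n) + e" if "Z u / of_nat n \<in> U" for u
      using that by (simp add: S_def)
    show ?case
    proof (intro allI impI)
      fix u assume u: "Z u / of_nat n \<in> U" "dist (Z u / of_nat n) p < min \<delta> d1"
      have "f p < f (Z u / of_nat n) + e"
        using \<delta>(2)[of "Z u / of_nat n"] u closure_subset[of U] by (force simp: abs_less_iff)
      then show "g n u \<le> f (Z u / of_nat n) + 5 * e"
        using *[OF u(1)] close[of "Z u / of_nat n"] u(2) by (simp add: W_def)
    qed
  qed
  then show ?thesis using \<delta>(1) d1(1) by (intro exI[of _ "min \<delta> d1"]) auto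
qed

text \<open>Compactness of the frontier turns the local barrier estimates into one on a boundary
  layer O'. The rest of the closure is a compact set K inside U, where the expansion of f is
  uniform.\<close>

lemma upper_bound:
  assumes smooth: "smooth_domain U" and f: "harmonic_on f U" and e: "e > 0"
  shows "\<forall>\<^sub>F n in sequentially. \<forall>u. Z u / of_nat n \<in> U \<longrightarrow> g n u \<le> f (Z u / of_nat n) + 7 * e"
proof -
  have "open U" using smooth by (simp add: smooth_domain_def)
  have "\<exists>d>0. \<forall>\<^sub>F n in sequentially. \<forall>u. Z u / of_nat n \<in> U \<longrightarrow>
    dist (Z u / of_nat n) p < d \<longrightarrow> g n u \<le> f (Z u / of_nat n) + 5 * e" if p: "p \<in> frontier U" for p
  proof -
    have "p \<in> closure U" using p by (simp add: frontier_def)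
    moreover obtain c r where "r > 0" "cmod (p - c) = r"
      "\<And>z. z \<in> closure U \<Longrightarrow> r\<^sup>2 + (cmod (z - p))\<^sup>2 / 2 \<le> (cmod (z - c))\<^sup>2"
      using exterior_ball[OF smooth p] by blast
    ultimately show ?thesis using near_boundary_point e by blast
  qed
  then have "\<forall>p\<in>frontier U. \<exists>d. d > 0 \<and> (\<forall>\<^sub>F n in sequentially. \<forall>u. Z u / of_nat n \<in> U \<longrightarrow>
    dist (Z u / of_nat n) p < d \<longrightarrow> g n u \<le> f (Z u / of_nat n) + 5 * e)" by (rule ballI)
  from bchoice[OF this] obtain d where d0: "\<forall>p\<in>frontier U. d p > 0 \<and>
    (\<forall>\<^sub>F n in sequentially. \<forall>u. Z u / of_nat n \<in> U \<longrightarrow>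
      dist (Z u / of_nat n) p < d p \<longrightarrow> g n u \<le> f (Z u / of_nat n) + 5 * e)"
    by (elim exE) (rule that)
  note d = bspec[OF d0, THEN conjunct1] bspec[OF d0, THEN conjunct2]
  have "compact (frontier U)" using bounded_U by (rule compact_frontier_bounded)
  then obtain X where X: "X \<subseteq> frontier U" "finite X" "frontier U \<subseteq> (\<Union>p\<in>X. ball p (d p))"
  proof (rule compactE_image)
    show "frontier U \<subseteq> (\<Union>p\<in>frontier U. ball p (d p))" using d(1) by force
  qed (use that in auto)
  define O' where "O' = (\<Union>p\<in>X. ball p (d p))"
  have near: "\<forall>\<^sub>F n in sequentially. \<forall>u. Z u / of_nat n \<in> U \<longrightarrow>
      Z u / of_nat n \<in> O' \<longrightarrow> g n u \<le> f (Z u / of_nat n) + 5 * e"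
  proof -
    have "\<forall>\<^sub>F n in sequentially. \<forall>p\<in>X. \<forall>u. Z u / of_nat n \<in> U \<longrightarrow>
      dist (Z u / of_nat n) p < d p \<longrightarrow> g n u \<le> f (Z u / of_nat n) + 5 * e"
      using X(1,2) d(2) by (intro eventually_ball_finite) auto
    then show ?thesis by eventually_elim (auto simp: O'_def dist_commute)
  qed
  define K where "K = closure U - O'"
  have K: "compact K" unfolding K_def O'_def by (intro compact_diff compact_closure_U open_UN) auto
  have KU: "K \<subseteq> U"
    using X(3) \<open>open U\<close> by (auto simp: K_def O'_def frontier_def interior_open)
  obtain R where R: "\<And>z. z \<in> U \<Longrightarrow> cmod z \<le> R" using bounded_U unfolding bounded_iff by blast
  define \<epsilon> where "\<epsilon> = e / (R\<^sup>2 + 1)"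
  have \<epsilon>: "\<epsilon> > 0" "\<epsilon> * R\<^sup>2 \<le> e"
  proof -
    have "R\<^sup>2 + 1 > 0" by (simp add: add_nonneg_pos)
    then show "\<epsilon> > 0" "\<epsilon> * R\<^sup>2 \<le> e" using e by (simp_all add: \<epsilon>_def field_simps)
  qed
  \<comment> \<open>On U the last term lies between 0 and e, so W dominates the bound 5 e in the
    boundary layer and costs at most 6 e. Of its quadratic loss \<epsilon> |h|^2, half pays for the
    Taylor error of f and half remains for \<open>comparison\<close>, which adds the seventh
    e.\<close>
  define W where "W = (\<lambda>z. f z + 5 * e + \<epsilon> * (R\<^sup>2 - (cmod z)\<^sup>2))"
  obtain s M where s: "s > 0" and quad: "\<And>v. v \<in> K \<Longrightarrow> \<exists>A B. cmod A \<le> M \<and> (\<forall>h. cmod h \<le> s \<longrightarrow>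
     \<bar>f (v + h) - (f v + Re (B * h) + Re (A * h\<^sup>2))\<bar> \<le> \<epsilon> / 2 * (cmod h)\<^sup>2)"
    using harmonic_on_quadratic[OF \<open>open U\<close> f K KU, of "\<epsilon> / 2"] \<epsilon>(1) by (metis half_gt_zero)
  have quadW: "\<exists>A B. cmod A \<le> M \<and> (\<forall>z. cmod (z - v) \<le> s \<longrightarrow>
       W z \<le> W v + Re (B * (z - v)) + Re (A * (z - v)\<^sup>2) - \<epsilon> / 2 * (cmod (z - v))\<^sup>2)"
    if v: "v \<in> K" for v
  proof -
    obtain A B where AB: "cmod A \<le> M" "\<And>h. cmod h \<le> s \<Longrightarrow>
       \<bar>f (v + h) - (f v + Re (B * h) + Re (A * h\<^sup>2))\<bar> \<le> \<epsilon> / 2 * (cmod h)\<^sup>2"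
      using quad[OF v] by blast
    have "W z \<le> W v + Re ((B - 2 * \<epsilon> * cnj v) * (z - v)) + Re (A * (z - v)\<^sup>2) - \<epsilon> / 2 * (cmod (z - v))\<^sup>2"
      if "cmod (z - v) \<le> s" for z
    proof -
      define h where "h = z - v"
      have z: "z = v + h" by (simp add: h_def)
      have sq: "(cmod z)\<^sup>2 = (cmod v)\<^sup>2 + 2 * Re (cnj v * h) + (cmod h)\<^sup>2"
        unfolding z cmod_power2 by (simp add: power2_eq_square algebra_simps)
      have B: "Re ((B - 2 * \<epsilon> * cnj v) * h) = Re (B * h) - 2 * \<epsilon> * Re (cnj v * h)"
        by (simp add: algebra_simps)
      have "f z \<le> f v + Re (B * h) + Re (A * h\<^sup>2) + \<epsilon> / 2 * (cmod h)\<^sup>2"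
        using AB(2)[OF that[folded h_def]] unfolding z by linarith
      then show ?thesis unfolding W_def h_def[symmetric] B sq by (simp add: algebra_simps)
    qed
    then show ?thesis using AB(1) by blast
  qed
  have comp: "\<forall>\<^sub>F n in sequentially. \<forall>S g'. (\<forall>u\<in>S. Z u / of_nat n \<in> K \<and> harmonic_at g' u) \<longrightarrow>
     (\<forall>u\<in>S. \<forall>x\<in>{P u, Q u}. x \<notin> S \<longrightarrow> g' x \<le> W (Z x / of_nat n)) \<longrightarrow>
     (\<forall>u\<in>S. g' u \<le> W (Z u / of_nat n) + e)"
    by (rule comparison[OF compact_imp_bounded[OF K] _ s e quadW]) (use \<epsilon> in auto)
  obtain d2 where d2: "d2 > 0" "\<And>z y. y \<in> K \<Longrightarrow> dist z y \<le> d2 \<Longrightarrow> z \<in> U"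
    using compact_uniform_near[OF K \<open>open U\<close> KU continuous_on_id e] by metis
  have W_bounds: "f z + 5 * e \<le> W z" "W z \<le> f z + 6 * e" if "z \<in> U" for z
  proof -
    have "(cmod z)\<^sup>2 \<le> R\<^sup>2" using R[OF that] by (intro power_mono) auto
    then have "0 \<le> \<epsilon> * (R\<^sup>2 - (cmod z)\<^sup>2)" "\<epsilon> * (R\<^sup>2 - (cmod z)\<^sup>2) \<le> \<epsilon> * R\<^sup>2"
      using \<epsilon>(1) by simp_all
    then show "f z + 5 * e \<le> W z" "W z \<le> f z + 6 * e" using \<epsilon>(2) by (simp_all add: W_def)
  qed
  show ?thesis
    using comp near step_eventually_small[OF d2(1)] eventually_ge_at_top[of 1]
  proof eventually_elim
    case (elim n)
    define S where "S = {u. Z u / of_nat n \<in> K}"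
    \<comment> \<open>A neighbour that leaves K is still in U, because K has positive distance to
      the complement; hence it lies in O', where the barrier estimate applies.\<close>
    have bd: "g n x \<le> W (Z x / of_nat n)" if u: "u \<in> S" and x: "x \<in> {P u, Q u}" "x \<notin> S" for u x
    proof -
      have "dist (Z x / of_nat n) (Z u / of_nat n) < d2" using elim(3) x(1) by blast
      then have xU: "Z x / of_nat n \<in> U" using d2(2)[of "Z u / of_nat n"] u by (simp add: S_def)
      moreover have "Z x / of_nat n \<in> O'"
        using xU x(2) closure_subset[of U] by (auto simp: S_def K_def)
      ultimately have "g n x \<le> f (Z x / of_nat n) + 5 * e" using elim(2) by blast
      then show ?thesis using W_bounds(1)[OF xU] by linarith
    qed
    have hs: "\<forall>u\<in>S. Z u / of_nat n \<in> K \<and> harmonic_at (g n) u"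
      using harm[OF elim(4)] KU by (auto simp: S_def)
    have bd': "\<forall>u\<in>S. \<forall>x\<in>{P u, Q u}. x \<notin> S \<longrightarrow> g n x \<le> W (Z x / of_nat n)"
      by (intro ballI impI) (rule bd)
    have *: "\<forall>u\<in>S. g n u \<le> W (Z u / of_nat n) + e"
      by (rule elim(1)[THEN spec, THEN spec, THEN mp, OF hs, THEN mp, OF bd'])
    show ?case
    proof (intro allI impI)
      fix u assume u: "Z u / of_nat n \<in> U"
      show "g n u \<le> f (Z u / of_nat n) + 7 * e"
      proof (cases "u \<in> S")
        case True
        then have "g n u \<le> W (Z u / of_nat n) + e" using * by blast
        then show ?thesis using W_bounds(2)[OF u] by linarith
      next
        case False
        then have "Z u / of_nat n \<in> O'" using u closure_subset[of U] by (auto simp: S_def K_def)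
        then have "g n u \<le> f (Z u / of_nat n) + 5 * e" using elim(2) u by blast
        then show ?thesis using e by linarith
      qed
    qed
  qed
qed

end

section \<open>Transfer to the rescaled T-graphs\<close>

lemma splits_sym: "splits \<phi> v p q \<Longrightarrow> splits \<phi> v q p"
  unfolding splits_def by (metis closed_segment_commute open_segment_commute)

lemma splits_rescaled:
  assumes "splits \<phi> v p q" "n \<ge> 1"
  shows "splits (rescaled n \<phi>) (v / of_nat n) (p / of_nat n) (q / of_nat n)"
proof -
  define h where "h = (\<lambda>z::complex. z / of_nat n)"
  have h: "linear h" "inj h"
    using assms(2) by (auto simp: h_def linear_iff add_divide_distrib scaleR_conv_of_real inj_def)
  obtain i j where ij: "closed_segment p q = black_face \<phi> i j"
    using assms(1) by (auto simp: splits_def segments_def)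
  have "closed_segment (h p) (h q) = h ` black_face \<phi> i j"
    by (simp only: closed_segment_linear_image[OF h(1)] ij)
  also have "\<dots> = black_face (rescaled n \<phi>) i j"
    unfolding black_face_def convex_hull_linear_image[OF h(1)] by (simp add: rescaled_def h_def)
  finally have "closed_segment (h p) (h q) \<in> segments (rescaled n \<phi>)" by (auto simp: segments_def)
  moreover have "h v \<in> open_segment (h p) (h q)"
    using assms(1) by (simp add: open_segment_linear_image[OF h] splits_def)
  ultimately show ?thesis by (simp add: splits_def h_def)
qed

text \<open>Since |p - v| = t |p - q| and |q - v| = (1 - t) |p - q|, clearing denominators turns the
  jump rates into the barycentric weights of v.\<close>

lemma discrete_harmonic_mean:
  assumes harm: "discrete_harmonic \<phi> h A" and "v \<in> A" "splits \<phi> v p q" "p \<noteq> q"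
    and t: "0 < t" "t < 1" and v: "v = of_real (1 - t) * p + of_real t * q"
  shows "h v = (1 - t) * h p + t * h q"
proof -
  define d where "d = cmod (p - q)"
  have d: "d > 0" using assms(4) by (simp add: d_def)
  have "p - v = of_real t * (p - q)" "q - v = of_real (1 - t) * (q - p)"
    unfolding v by (simp_all add: algebra_simps)
  then have n: "cmod (p - v) = t * d" "cmod (q - v) = (1 - t) * d"
    using t by (simp_all add: norm_mult d_def norm_minus_commute del: of_real_diff)
  have "(h p - h v) / (t * d) + (h q - h v) / ((1 - t) * d) = 0"
    using harm assms(2,3) unfolding discrete_harmonic_def n[symmetric] by blast
  moreover have "(h p - h v) / (t * d) + (h q - h v) / ((1 - t) * d)
      = ((1 - t) * (h p - h v) + t * (h q - h v)) / (t * (1 - t) * d)"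
    using t d by (simp add: field_simps)
  ultimately have "(1 - t) * (h p - h v) + t * (h q - h v) = 0" using t d by simp
  then show ?thesis by (simp add: algebra_simps)
qed

text \<open>The first-order identity is proved on all of the open set U, so that it can be
  differentiated once more.\<close>

lemma harmonic_on_uminus:
  assumes "open U" "harmonic_on f U"
  shows "harmonic_on (\<lambda>z. - f z) U"
proof -
  have C2: "Ck_on 2 f U" using assms(2) by (simp add: harmonic_on_def)
  note D = Ck_on_2D[OF assms(1) C2]
  have d1: "((\<lambda>z. - f z) has_derivative (\<lambda>v. - dir_deriv v f z)) (at z)" if "z \<in> U" for z
    using D(1)[OF that] unfolding frechet_derivative_works by (rule has_derivative_minus)
  then have e1: "dir_deriv v (\<lambda>z. - f z) z = - dir_deriv v f z" if "z \<in> U" for v z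
    using fun_cong[OF frechet_derivative_at[OF d1[OF that]], of v] by simp
  have d2: "(dir_deriv v (\<lambda>z. - f z) has_derivative (\<lambda>w. - dir_deriv w (dir_deriv v f) z)) (at z)"
    if "z \<in> U" for v z
  proof (rule has_derivative_transform_within_open[OF _ assms(1) that])
    show "((\<lambda>z. - dir_deriv v f z) has_derivative (\<lambda>w. - dir_deriv w (dir_deriv v f) z)) (at z)"
      using D(2)[OF that] unfolding frechet_derivative_works by (rule has_derivative_minus)
  qed (rule e1[symmetric])
  have e2: "dir_deriv w (dir_deriv v (\<lambda>z. - f z)) z = - dir_deriv w (dir_deriv v f) z"
    if "z \<in> U" for v w z
    using fun_cong[OF frechet_derivative_at[OF d2[OF that, where v = v]], of w] by simp
  have "continuous_on U (dir_deriv w (dir_deriv v (\<lambda>z. - f z)))" for v w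
    using continuous_on_minus[OF D(3)] by (rule continuous_on_eq) (rule e2[symmetric])
  moreover have "(\<lambda>z. - f z) differentiable_on U" "dir_deriv v (\<lambda>z. - f z) differentiable_on U" for v
    using d1 d2 assms(1) unfolding differentiable_on_eq_differentiable_at[OF assms(1)] differentiable_def
    by blast+
  ultimately have "Ck_on 2 (\<lambda>z. - f z) U" by (simp add: numeral_2_eq_2)
  moreover have "dir_deriv 1 (dir_deriv 1 (\<lambda>z. - f z)) z + dir_deriv \<i> (dir_deriv \<i> (\<lambda>z. - f z)) z = 0"
    if z: "z \<in> U" for z
  proof -
    have "dir_deriv 1 (dir_deriv 1 f) z + dir_deriv \<i> (dir_deriv \<i> f) z = 0"
      using assms(2) z unfolding harmonic_on_def by blast
    then show ?thesis unfolding e2[OF z] by linarith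
  qed
  ultimately show ?thesis unfolding harmonic_on_def by blast
qed

text \<open>The solution is pulled back to lattice indices along \<psi> / n, and discrete
  harmonicity is used on the segment that \<open>balanced\<close> selects at each index. The
  resulting bound holds at all inner vertices at once.\<close>

lemma tgraph_upper_bound:
  fixes lam \<alpha> \<beta> \<gamma> :: complex and a b c :: real
  defines "\<psi> \<equiv> psi lam a b c \<alpha> \<beta> \<gamma>"
  assumes U: "smooth_domain U" "bounded U" and f: "harmonic_on f U" "continuous_on (closure U) f"
    and tgraph: "cmod lam = 1" "unit_area_triangle a b c \<alpha> \<beta> \<gamma>" "nondegenerate \<psi>"
    and h: "\<And>n. n \<ge> 1 \<Longrightarrow> dirichlet_solution (rescaled n \<psi>) U f (h n)" and e: "e > 0"
  shows "\<forall>\<^sub>F n in sequentially. \<forall>v\<in>inner_vertices (rescaled n \<psi>) U. h n v \<le> f v + e"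
proof -
  interpret T: tgraph lam a b c \<alpha> \<beta> \<gamma> using tgraph by unfold_locales
  obtain G P Q t C where "balanced_graph (case_prod \<psi>) G P Q t C (a + b + c)"
    and splits: "\<And>u. splits \<psi> (case_prod \<psi> u) (case_prod \<psi> (P u)) (case_prod \<psi> (Q u))"
    using T.balanced[folded \<psi>_def, OF tgraph(3)] by blast
  then interpret balanced_graph "case_prod \<psi>" G P Q t C "a + b + c" by simp
  define z where "z = (\<lambda>n u. case_prod \<psi> u / of_nat n)"
  have vert: "z n u \<in> vertices (rescaled n \<psi>)" for n u
    by (auto simp: z_def vertices_def rescaled_def split: prod.splits)
  have spl: "splits (rescaled n \<psi>) (z n u) (z n (P u)) (z n (Q u))" if "n \<ge> 1" for n u
    unfolding z_def using splits that by (rule splits_rescaled)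
  interpret discrete_dirichlet "case_prod \<psi>" G P Q t C "a + b + c" U f "\<lambda>n u. h n (z n u)"
  proof
    show "bounded U" "continuous_on (closure U) f" by fact+
  next
    fix n u assume n: "(1::nat) \<le> n" and "case_prod \<psi> u / of_nat n \<in> U"
    then have mem: "z n u \<in> inner_vertices (rescaled n \<psi>) U"
      using vert by (simp add: inner_vertices_def z_def)
    have ne: "z n (P u) \<noteq> z n (Q u)" using PQ[of u] n by (simp add: z_def)
    have mid: "z n u = of_real (1 - t u) * z n (P u) + of_real (t u) * z n (Q u)"
      unfolding z_def by (subst Z) (simp add: add_divide_distrib)
    have "discrete_harmonic (rescaled n \<psi>) (h n) (inner_vertices (rescaled n \<psi>) U)"
      using h[OF n] unfolding dirichlet_solution_def by blast
    from discrete_harmonic_mean[OF this mem spl[OF n] ne t mid]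
    show "harmonic_at (\<lambda>u. h n (z n u)) u" by (simp add: harmonic_at_def)
  next
    fix n u x assume n: "(1::nat) \<le> n" and u: "case_prod \<psi> u / of_nat n \<in> U"
      and x: "x \<in> {P u, Q u}" "case_prod \<psi> x / of_nat n \<notin> U"
    have "z n u \<in> inner_vertices (rescaled n \<psi>) U"
      using vert u by (simp add: inner_vertices_def z_def)
    moreover have "\<exists>q. splits (rescaled n \<psi>) (z n u) (z n x) q"
      using spl[OF n, of u] x(1) splits_sym by blast
    moreover have "z n x \<notin> inner_vertices (rescaled n \<psi>) U"
      using x(2) by (simp add: inner_vertices_def z_def)
    ultimately have "z n x \<in> boundary_vertices (rescaled n \<psi>) U"
      using vert unfolding boundary_vertices_def by blast
    then have "h n (z n x) = f (closest_point (closure U) (z n x))"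
      using h[OF n] unfolding dirichlet_solution_def by blast
    then show "h n (z n x) = f (closest_point (closure U) (case_prod \<psi> x / of_nat n))"
      by (simp add: z_def)
  qed
  have "e / 7 > 0" using e by simp
  from upper_bound[OF U(1) f(1) this] show ?thesis
  proof eventually_elim
    case (elim n)
    show ?case
    proof
      fix v assume v: "v \<in> inner_vertices (rescaled n \<psi>) U"
      then obtain i j where "v = \<psi> i j / of_nat n"
        by (auto simp: inner_vertices_def vertices_def rescaled_def)
      then have vz: "v = case_prod \<psi> (i, j) / of_nat n" by simp
      then have "case_prod \<psi> (i, j) / of_nat n \<in> U" using v by (simp add: inner_vertices_def)
      from elim[THEN spec, THEN mp, OF this] show "h n v \<le> f v + e"
        by (simp only: z_def vz)
    qed
  qed
qed

theorem corollary2p19: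
  fixes U :: "complex set" and f :: "complex \<Rightarrow> real"
    and lam \<alpha> \<beta> \<gamma> :: complex and a b c :: real
    and T :: "nat \<Rightarrow> int \<Rightarrow> int \<Rightarrow> complex"
    and fn :: "nat \<Rightarrow> complex \<Rightarrow> real"
    and v :: "nat \<Rightarrow> complex" and v_inf :: complex
  assumes "smooth_domain U" and "bounded U"
    and "harmonic_on f U" and "continuous_on (closure U) f"
    and "cmod lam = 1" and "unit_area_triangle a b c \<alpha> \<beta> \<gamma>"
    and "nondegenerate (psi lam a b c \<alpha> \<beta> \<gamma>)"
    and "\<And>n. T n = rescaled n (psi lam a b c \<alpha> \<beta> \<gamma>)"
    and "\<And>n. n \<ge> 1 \<Longrightarrow> dirichlet_solution (T n) U f (fn n)"
    and "v_inf \<in> U"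
    and "\<forall>\<^sub>F n in sequentially. v n \<in> inner_vertices (T n) U"
    and "v \<longlonglongrightarrow> v_inf"
  shows "(\<lambda>n. fn n (v n)) \<longlonglongrightarrow> f v_inf"
proof -
  have T: "T = (\<lambda>n. rescaled n (psi lam a b c \<alpha> \<beta> \<gamma>))" using assms(8) by blast
  note sol = assms(9)[unfolded T]
  have "open U" using assms(1) by (simp add: smooth_domain_def)
  have sol': "dirichlet_solution (rescaled n (psi lam a b c \<alpha> \<beta> \<gamma>)) U (\<lambda>z. - f z) (\<lambda>z. - fn n z)"
    if n: "n \<ge> 1" for n
  proof -
    have "(- x - - y) / r + (- x' - - y) / r' = - ((x - y) / r + (x' - y) / r')" for x y x' r r' :: real
      by (simp add: diff_divide_distrib)
    then show ?thesis
      using sol[OF n] by (simp only: dirichlet_solution_def discrete_harmonic_def neg_equal_0_iff_equal neg_equal_iff_equal)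
  qed
  note bound = tgraph_upper_bound[OF assms(1,2) _ _ assms(5,6,7)]
  \<comment> \<open>Both bounds are uniform over the inner vertices, so they may be evaluated at the
    moving point v n; continuity of f at the limit does the rest.\<close>
  have "(\<lambda>n. fn n (v n) - f (v n)) \<longlonglongrightarrow> 0"
  proof (rule tendstoI)
    fix e :: real assume "e > 0"
    then have e: "e / 2 > 0" by simp
    have "continuous_on (closure U) (\<lambda>z. - f z)" by (intro continuous_on_minus assms(4))
    then have "\<forall>\<^sub>F n in sequentially. \<forall>v\<in>inner_vertices (rescaled n (psi lam a b c \<alpha> \<beta> \<gamma>)) U.
        - fn n v \<le> - f v + e / 2"
      by (rule bound[OF harmonic_on_uminus[OF \<open>open U\<close> assms(3)] _ _ e]) (rule sol')
    moreover have "\<forall>\<^sub>F n in sequentially. \<forall>v\<in>inner_vertices (rescaled n (psi lam a b c \<alpha> \<beta> \<gamma>)) U.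
        fn n v \<le> f v + e / 2"
      by (rule bound[OF assms(3,4) _ e]) (rule sol)
    ultimately show "\<forall>\<^sub>F n in sequentially. dist (fn n (v n) - f (v n)) 0 < e"
      using assms(11)[unfolded T]
    proof eventually_elim
      case (elim n)
      have "fn n (v n) \<le> f (v n) + e / 2" "- fn n (v n) \<le> - f (v n) + e / 2"
        using elim(1,2)[THEN bspec, OF elim(3)] by simp_all
      then show ?case using \<open>e > 0\<close> unfolding dist_real_def by linarith
    qed
  qed
  moreover have "(\<lambda>n. f (v n)) \<longlonglongrightarrow> f v_inf"
  proof -
    have "continuous_on U f" using assms(4) closure_subset continuous_on_subset by blast
    then have "isCont f v_inf" using \<open>open U\<close> assms(10) by (simp add: continuous_on_eq_continuous_at)
    then show ?thesis using assms(12) by (rule isCont_tendsto_compose)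
  qed
  ultimately have "(\<lambda>n. (fn n (v n) - f (v n)) + f (v n)) \<longlonglongrightarrow> 0 + f v_inf" by (rule tendsto_add)
  then show ?thesis by simp
qed

end
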